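(* Let $(\xi_k)_{k\ge 1}$ be independent random variables with values in $\{0,1\}$ and $\mathbb{P}(\xi_k=1)=\frac{\log k}{k}$, and let $T=T(\omega)=\{k\ge1:\xi_k(\omega)=1\}$. Almost surely, the set $T$ is $p$-Rider for every $p$ with $4/3<p<2$, and is not $p$-Rider for any $p$ with $1\le p<4/3$.
   Context: Let $e_n(x)=e^{2\pi i nx}$ on $\mathbb{T}=\mathbb{R}/\mathbb{Z}$. For a trigonometric polynomial $P=\sum_n\widehat P(n)e_n$, put $[[P]]=\mathbb{E}\big\|\sum_n\varepsilon_n\widehat P(n)e_n\big\|_\infty$, where $(\varepsilon_n)$ is a sequence of independent Rademacher variables (values $\pm1$ with probability $1/2$). For $1\le p<2$, a set $E$ of positive integers is called a $p$-Rider set if there is a constant $C$ such that $\big(\sum_n|\widehat f(n)|^p\big)^{1/p}\le C\,[[f]]$ for all trigonometric polynomials $f$ with spectrum in $E$ (i.e. $\widehat f(n)=0$ for $n\notin E$). *)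

theory Defs
  imports "HOL-Probability.Probability"
begin

text \<open>Functions on the circle are functions on the reals; every trigonometric polynomial below
  is automatically 1-periodic.\<close>

definition char_fn :: "int \<Rightarrow> real \<Rightarrow> complex" where
  "char_fn n x = exp (2 * of_real pi * \<i> * of_int n * of_real x)"

definition trig_poly :: "(real \<Rightarrow> complex) \<Rightarrow> bool" where
  "trig_poly f \<longleftrightarrow> (\<exists>A c. finite A \<and> f = (\<lambda>x. \<Sum>n\<in>A. c n * char_fn n x))"

definition fourier_coeff :: "(real \<Rightarrow> complex) \<Rightarrow> int \<Rightarrow> complex" where
  "fourier_coeff f n = integral {0..1} (\<lambda>x. f x * char_fn (- n) x)"

definition fourier_spectrum :: "(real \<Rightarrow> complex) \<Rightarrow> int set" where
  "fourier_spectrum f = {n. fourier_coeff f n \<noteq> 0}"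

definition sup_norm :: "(real \<Rightarrow> complex) \<Rightarrow> real" where
  "sup_norm f = (SUP x. norm (f x))"

text \<open>The law of an independent Rademacher sequence indexed by the integers; the coordinate
  functions are such a sequence, and \<open>rider_norm\<close> depends only on their joint law.\<close>

definition rademacher_seq :: "(int \<Rightarrow> real) measure" where
  "rademacher_seq = (\<Pi>\<^sub>M n\<in>UNIV. measure_pmf (pmf_of_set {-1, 1}))"

text \<open>The spectrum of a trigonometric polynomial is finite, so the sums over it are genuine.\<close>

definition rider_norm :: "(real \<Rightarrow> complex) \<Rightarrow> real" where
  "rider_norm f = (LINT \<epsilon>|rademacher_seq.
     sup_norm (\<lambda>x. \<Sum>n\<in>fourier_spectrum f. of_real (\<epsilon> n) * fourier_coeff f n * char_fn n x))"

definition p_Rider :: "real \<Rightarrow> nat set \<Rightarrow> bool" where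
  "p_Rider p E \<longleftrightarrow>
     (\<exists>C::real. \<forall>f. trig_poly f \<and> fourier_spectrum f \<subseteq> int ` E \<longrightarrow>
        (\<Sum>n\<in>fourier_spectrum f. norm (fourier_coeff f n) powr p) powr (1 / p) \<le> C * rider_norm f)"

end

theory Submission imports Defs begin

text \<open>Positive part. Let \<open>B\<close> be a set of frequencies of a polynomial \<open>f\<close> in which no nonempty signed
  sum of fewer than \<open>s\<close> elements vanishes. Pairing the random polynomial
  \<open>\<Sum> \<epsilon>\<^sub>n a\<^sub>n e\<^sub>n\<close> with the random Riesz product \<open>\<Prod>\<^sub>B (1 + \<theta> \<epsilon>\<^sub>n cos (2\<pi>nx + arg a\<^sub>n))\<close>,
  \<open>\<theta>\<^sup>2 = s / (e |B|)\<close>, whose mean over \<open>x\<close> has second moment at most 2 by the absence of short relations,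
  gives \<open>\<Sum>\<^sub>B |a\<^sub>n| \<le> 4 \<surd>(e |B| / s) [[f]]\<close>. Almost surely the relations among elements of \<open>T\<close>
  of size about \<open>2\<^sup>j\<close> have length at least of order \<open>j / log j\<close>, while \<open>T\<close> has of order \<open>j\<^sup>2\<close> elements
  below \<open>2\<^sup>j\<close>; hence \<open>s\<close> is almost \<open>\<surd>|B|\<close> after discarding the small half of \<open>B\<close>, and the \<open>m\<close>-th
  largest coefficient of \<open>f\<close> is at most a constant times \<open>m\<close> to a power close to \<open>-3/4\<close> times \<open>[[f]]\<close>.

  Negative part. The sum \<open>f\<close> of the \<open>e\<^sub>n\<close> with \<open>n \<in> T\<close>, \<open>n < 2\<^sup>J\<close>, has \<open>m\<close> of order \<open>J\<^sup>2\<close>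
  unit coefficients, whereas exponential moments on a grid give \<open>[[f]] \<le> 19 \<surd>(m J)\<close>.\<close>

section \<open>Averages over signs\<close>

text \<open>Finite form of the Rademacher expectation, for functionals of the signs in
  \<open>A\<close> only; \<open>integral_rademacher_seq\<close> links it to the integral.
  Extensionality makes the set of sign patterns finite.\<close>

definition sign_mean :: "'i set \<Rightarrow> (('i \<Rightarrow> real) \<Rightarrow> real) \<Rightarrow> real" where
  "sign_mean A g = (\<Sum>\<epsilon>\<in>PiE A (\<lambda>_. {-1, 1}). g \<epsilon>) / 2 ^ card A"

lemma sign_mean_empty [simp]: "sign_mean {} g = g (\<lambda>_. undefined)"
  by (simp add: sign_mean_def)

text \<open>Conditioning on the sign at \<open>i\<close>; the inductions on the index set go through
  this identity.\<close>

lemma sign_mean_insert: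
  assumes "finite A" "i \<notin> A"
  shows "sign_mean (insert i A) g = sign_mean A (\<lambda>\<epsilon>. (g (\<epsilon>(i := 1)) + g (\<epsilon>(i := -1))) / 2)"
proof -
  have "(\<Sum>\<epsilon>\<in>PiE (insert i A) (\<lambda>_. {-1, 1}). g \<epsilon>)
      = (\<Sum>(y, \<epsilon>)\<in>{-1, 1} \<times> PiE A (\<lambda>_. {-1, 1}). g (\<epsilon>(i := y)))"
    unfolding PiE_insert_eq using inj_combinator[OF assms(2), of "\<lambda>_. {-1, 1::real}"]
    by (subst sum.reindex) (auto simp: case_prod_unfold)
  also have "\<dots> = (\<Sum>y\<in>{-1, 1}. \<Sum>\<epsilon>\<in>PiE A (\<lambda>_. {-1, 1}). g (\<epsilon>(i := y)))"
    by (subst sum.cartesian_product) simp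
  also have "\<dots> = (\<Sum>\<epsilon>\<in>PiE A (\<lambda>_. {-1, 1}). g (\<epsilon>(i := 1)) + g (\<epsilon>(i := -1)))"
    by (simp add: sum.distrib)
  finally show ?thesis
    using assms by (simp add: sign_mean_def sum_divide_distrib)
qed

lemma sign_mean_mono:
  assumes "\<And>\<epsilon>. \<epsilon> \<in> PiE A (\<lambda>_. {-1, 1}) \<Longrightarrow> g \<epsilon> \<le> h \<epsilon>"
  shows "sign_mean A g \<le> sign_mean A h"
  unfolding sign_mean_def by (intro divide_right_mono sum_mono assms) auto

lemma sign_mean_cong:
  assumes "\<And>\<epsilon>. \<epsilon> \<in> PiE A (\<lambda>_. {-1, 1}) \<Longrightarrow> g \<epsilon> = h \<epsilon>"
  shows "sign_mean A g = sign_mean A h"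
  unfolding sign_mean_def using assms by simp

lemma sign_mean_add: "sign_mean A (\<lambda>\<epsilon>. g \<epsilon> + h \<epsilon>) = sign_mean A g + sign_mean A h"
  by (simp add: sign_mean_def sum.distrib add_divide_distrib)

lemma sign_mean_cmult: "sign_mean A (\<lambda>\<epsilon>. c * g \<epsilon>) = c * sign_mean A g"
  by (simp add: sign_mean_def sum_distrib_left)

lemma sign_mean_sum: "sign_mean A (\<lambda>\<epsilon>. \<Sum>x\<in>X. g x \<epsilon>) = (\<Sum>x\<in>X. sign_mean A (g x))"
  unfolding sign_mean_def by (subst sum.swap) (simp add: sum_divide_distrib)

text \<open>Independence of the signs, which for finite means is the distributive law.\<close>

lemma sign_mean_prod:
  assumes "finite A"
  shows "sign_mean A (\<lambda>\<epsilon>. \<Prod>n\<in>A. h n (\<epsilon> n)) = (\<Prod>n\<in>A. (h n 1 + h n (-1)) / 2)"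
proof -
  have "(\<Sum>\<epsilon>\<in>PiE A (\<lambda>_. {-1, 1}). \<Prod>n\<in>A. h n (\<epsilon> n)) = (\<Prod>n\<in>A. \<Sum>e\<in>{-1, 1}. h n e)"
    using assms by (subst prod_sum_PiE) auto
  then show ?thesis
    by (simp add: sign_mean_def prod_dividef algebra_simps)
qed

lemma sign_mean_const: "finite A \<Longrightarrow> sign_mean A (\<lambda>_. c) = c"
  using sign_mean_cmult[of A c "\<lambda>_. 1"] sign_mean_prod[of A "\<lambda>_ _. 1"] by simp

text \<open>Signs off \<open>B\<close> are averaged out one at a time. This allows the second moment
  of a Riesz product over \<open>B\<close> to be computed on \<open>B\<close> alone, while the
  polynomial lives on \<open>A\<close>.\<close>

lemma sign_mean_restrict:
  assumes "finite A" "B \<subseteq> A" and g: "\<And>\<epsilon> \<delta>. (\<And>n. n \<in> B \<Longrightarrow> \<epsilon> n = \<delta> n) \<Longrightarrow> g \<epsilon> = g \<delta>"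
  shows "sign_mean A g = sign_mean B g"
proof -
  have "finite B" using assms(1,2) by (rule rev_finite_subset)
  have "finite C \<Longrightarrow> C \<inter> B = {} \<Longrightarrow> sign_mean (C \<union> B) g = sign_mean B g" for C
  proof (induction rule: finite_induct)
    case (insert i C)
    have "sign_mean (insert i C \<union> B) g = sign_mean (C \<union> B) (\<lambda>\<epsilon>. (g (\<epsilon>(i := 1)) + g (\<epsilon>(i := -1))) / 2)"
      using insert \<open>finite B\<close> by (simp add: sign_mean_insert)
    also have "\<dots> = sign_mean (C \<union> B) g"
    proof (intro sign_mean_cong)
      fix \<epsilon> :: "'a \<Rightarrow> real"
      have "g (\<epsilon>(i := y)) = g \<epsilon>" for y using insert.prems by (intro g) auto
      then show "(g (\<epsilon>(i := 1)) + g (\<epsilon>(i := -1))) / 2 = g \<epsilon>" by simp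
    qed
    finally show ?case using insert by auto
  qed simp
  from this[of "A - B"] assms show ?thesis
    by (metis Diff_disjoint Int_commute Un_Diff_cancel2 Un_absorb2 finite_Diff)
qed

text \<open>The induction step is the parallelogram identity
  \<open>(u\<^sup>2 + v\<^sup>2) / 2 = ((u + v) / 2)\<^sup>2 + ((u - v) / 2)\<^sup>2\<close>.\<close>

lemma sign_mean_square_le:
  assumes "finite A"
    and "\<And>\<epsilon> i. i \<in> A \<Longrightarrow> \<bar>g (\<epsilon>(i := 1)) - g (\<epsilon>(i := -1))\<bar> \<le> 2 * b i"
  shows "sign_mean A (\<lambda>\<epsilon>. (g \<epsilon>)\<^sup>2) \<le> (sign_mean A g)\<^sup>2 + (\<Sum>i\<in>A. (b i)\<^sup>2)"
  using assms
proof (induction arbitrary: g rule: finite_induct)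
  case (insert i A)
  define h where "h = (\<lambda>\<epsilon>. (g (\<epsilon>(i := 1)) + g (\<epsilon>(i := -1))) / 2)"
  have h: "\<bar>h (\<epsilon>(j := 1)) - h (\<epsilon>(j := -1))\<bar> \<le> 2 * b j" if "j \<in> A" for \<epsilon> j
  proof -
    have "j \<noteq> i" using that insert by auto
    then have tw: "\<epsilon>(j := x, i := y) = \<epsilon>(i := y, j := x)" for x y by auto
    have "\<bar>g (\<epsilon>(i := y, j := 1)) - g (\<epsilon>(i := y, j := -1))\<bar> \<le> 2 * b j" for y
      using insert.prems[of j] that by blast
    from this[of 1] this[of "-1"] show ?thesis
      unfolding h_def tw abs_le_iff by argo
  qed
  have "sign_mean (insert i A) (\<lambda>\<epsilon>. (g \<epsilon>)\<^sup>2)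
      = sign_mean A (\<lambda>\<epsilon>. ((g (\<epsilon>(i := 1)))\<^sup>2 + (g (\<epsilon>(i := -1)))\<^sup>2) / 2)"
    using insert by (simp add: sign_mean_insert)
  also have "\<dots> \<le> sign_mean A (\<lambda>\<epsilon>. (h \<epsilon>)\<^sup>2 + (b i)\<^sup>2)"
  proof (rule sign_mean_mono)
    fix \<epsilon>
    let ?u = "g (\<epsilon>(i := 1))" and ?v = "g (\<epsilon>(i := -1))"
    have "\<bar>?u - ?v\<bar> \<le> 2 * b i" using insert.prems by blast
    then have "\<bar>(?u - ?v) / 2\<bar> \<le> b i" by (simp del: fun_upd_apply)
    then have "((?u - ?v) / 2)\<^sup>2 \<le> (b i)\<^sup>2" by (metis abs_ge_zero power2_abs power_mono)
    moreover have "(?u\<^sup>2 + ?v\<^sup>2) / 2 = (h \<epsilon>)\<^sup>2 + ((?u - ?v) / 2)\<^sup>2"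
      by (simp add: h_def power2_eq_square field_simps)
    ultimately show "(?u\<^sup>2 + ?v\<^sup>2) / 2 \<le> (h \<epsilon>)\<^sup>2 + (b i)\<^sup>2" by simp
  qed
  also have "\<dots> = sign_mean A (\<lambda>\<epsilon>. (h \<epsilon>)\<^sup>2) + (b i)\<^sup>2"
    using insert by (simp add: sign_mean_add sign_mean_const)
  also have "\<dots> \<le> (sign_mean A h)\<^sup>2 + (\<Sum>i\<in>A. (b i)\<^sup>2) + (b i)\<^sup>2"
    using insert.IH[OF h] by simp
  also have "sign_mean A h = sign_mean (insert i A) g"
    using insert by (simp add: sign_mean_insert h_def)
  finally show ?case using insert by simp
qed simp

text \<open>The average of cos (z + t) and cos (z - t) is cos z cos t, so each averaged sign splits
  off one factor.\<close>

lemma prod_cos_eq_sign_mean: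
  assumes "finite S"
  shows "cos u * (\<Prod>n\<in>S. cos (t n)) = sign_mean S (\<lambda>\<sigma>. cos (u + (\<Sum>n\<in>S. \<sigma> n * t n)))"
  using assms
proof (induction arbitrary: u rule: finite_induct)
  case (insert i S)
  have *: "(\<Sum>n\<in>S. (\<sigma>(i := y)) n * t n) = (\<Sum>n\<in>S. \<sigma> n * t n)" for \<sigma> y
    using insert by (intro sum.cong) auto
  have "sign_mean (insert i S) (\<lambda>\<sigma>. cos (u + (\<Sum>n\<in>insert i S. \<sigma> n * t n)))
     = sign_mean S (\<lambda>\<sigma>. cos (t i) * cos (u + (\<Sum>n\<in>S. \<sigma> n * t n)))"
    using insert unfolding sign_mean_insert[OF insert(1,2)]
    by (intro sign_mean_cong)
      (simp add: * del: fun_upd_apply, simp add: cos_add cos_diff sin_add sin_diff algebra_simps)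
  also have "\<dots> = cos (t i) * (cos u * (\<Prod>n\<in>S. cos (t n)))"
    by (simp only: sign_mean_cmult insert.IH)
  finally show ?case using insert(1,2) by (simp add: mult_ac)
qed simp

section \<open>Cosine sums on a grid\<close>

lemma norm_char_fn [simp]: "norm (char_fn n x) = 1"
proof -
  have "char_fn n x = exp (\<i> * of_real (2 * pi * of_int n * x))"
    by (simp add: char_fn_def mult_ac)
  then show ?thesis by (simp add: norm_exp_i_times)
qed

lemma char_fn_cis: "char_fn n x = cis (2 * pi * of_int n * x)"
  by (simp add: char_fn_def cis_conv_exp mult_ac)

text \<open>Real part of a geometric sum whose ratio is a \<open>Q\<close>-th root of unity other
  than 1. Means over the grid \<open>k / Q\<close> take the place of integrals over the circle in
  the Riesz product argument.\<close>

lemma sum_cos_grid_eq_0: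
  fixes n :: int and Q :: nat
  assumes "Q > 0" "\<not> int Q dvd n"
  shows "(\<Sum>k<Q. cos (2 * pi * of_int n * (real k / real Q) + \<phi>)) = 0"
proof -
  define z where "z = cis (2 * pi * of_int n / real Q)"
  have "z ^ Q = cis (2 * pi * of_int n)"
    unfolding z_def Complex.DeMoivre using assms by simp
  also have "\<dots> = 1" by (simp add: cis_multiple_2pi)
  finally have zQ: "z ^ Q = 1" .
  have "z \<noteq> 1"
  proof
    assume "z = 1"
    then have "cos (2 * pi * of_int n / real Q) = 1" unfolding z_def by (metis cis.sel(1) one_complex.sel(1))
    then obtain m :: int where "2 * pi * of_int n / real Q = of_int m * (2 * pi)"
      using cos_one_2pi_int by auto
    then have "real_of_int n = real_of_int (m * int Q)"
      using assms by (simp add: field_simps)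
    then have "n = m * int Q" by (simp only: of_int_eq_iff)
    with assms show False by simp
  qed
  have "(\<Sum>k<Q. cis (2 * pi * of_int n * (real k / real Q) + \<phi>)) = cis \<phi> * (\<Sum>k<Q. z ^ k)"
    unfolding z_def Complex.DeMoivre sum_distrib_left cis_mult by (intro sum.cong) (simp_all add: field_simps)
  also have "\<dots> = 0" using zQ \<open>z \<noteq> 1\<close> by (simp add: sum_gp_strict)
  finally have "Re (\<Sum>k<Q. cis (2 * pi * of_int n * (real k / real Q) + \<phi>)) = 0" by simp
  then show ?thesis by simp
qed

lemma sum_cos_square_grid:
  fixes n :: int and Q :: nat
  assumes "Q > 0" "\<not> int Q dvd 2 * n"
  shows "(\<Sum>k<Q. (cos (2 * pi * of_int n * (real k / real Q) + \<phi>))\<^sup>2) = real Q / 2"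
proof -
  have "(cos (2 * pi * of_int n * (real k / real Q) + \<phi>))\<^sup>2
      = 1 / 2 + cos (2 * pi * of_int (2 * n) * (real k / real Q) + 2 * \<phi>) / 2" for k
    using cos_double_cos[of "2 * pi * of_int n * (real k / real Q) + \<phi>"]
    by (simp add: algebra_simps)
  then show ?thesis
    using sum_cos_grid_eq_0[OF assms, of "2 * \<phi>"]
    by (simp only: sum.distrib sum_divide_distrib[symmetric]) simp
qed

text \<open>Coefficients are \<plusminus>1 and never 0, so all of \<open>S\<close> takes part in a
  relation, and shorter relations are found by passing to subsets. The empty set is not relation
  free, whence the conditions \<open>S \<noteq> {}\<close> later on.\<close>

definition relation_free :: "int set \<Rightarrow> bool" where
  "relation_free S \<longleftrightarrow> (\<forall>c. (\<forall>n\<in>S. c n \<in> {-1, 1}) \<longrightarrow> (\<Sum>n\<in>S. c n * n) \<noteq> 0)"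

text \<open>After the product is turned into a mean of cosines, the frequencies are the signed sums
  of \<open>S\<close>. They are nonzero and of modulus less than \<open>Q\<close>, hence not
  divisible by \<open>Q\<close>.\<close>

lemma sum_prod_cos_grid_eq_0:
  fixes S :: "int set" and Q :: nat
  assumes "finite S" "relation_free S" "(\<Sum>n\<in>S. \<bar>n\<bar>) < int Q"
  shows "(\<Sum>k<Q. \<Prod>n\<in>S. cos (2 * pi * of_int n * (real k / real Q) + \<phi> n)) = 0"
proof -
  have "(\<Sum>k<Q. \<Prod>n\<in>S. cos (2 * pi * of_int n * (real k / real Q) + \<phi> n))
      = sign_mean S (\<lambda>\<sigma>. \<Sum>k<Q. cos (\<Sum>n\<in>S. \<sigma> n * (2 * pi * of_int n * (real k / real Q) + \<phi> n)))"
    using prod_cos_eq_sign_mean[OF assms(1), of 0] by (simp add: sign_mean_sum)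
  also have "\<dots> = sign_mean S (\<lambda>\<sigma>. 0)"
  proof (rule sign_mean_cong)
    fix \<sigma> assume \<sigma>: "\<sigma> \<in> S \<rightarrow>\<^sub>E {-1, 1::real}"
    define c :: "int \<Rightarrow> int" where "c = (\<lambda>n. if \<sigma> n = 1 then 1 else -1)"
    have c: "\<sigma> n = of_int (c n)" if "n \<in> S" for n
      using PiE_mem[OF \<sigma> that] by (auto simp: c_def)
    define z where "z = (\<Sum>n\<in>S. c n * n)"
    have "z \<noteq> 0" using assms(2) unfolding relation_free_def z_def by (simp add: c_def)
    have "\<bar>z\<bar> \<le> (\<Sum>n\<in>S. \<bar>c n * n\<bar>)" unfolding z_def by (rule sum_abs)
    also have "\<dots> = (\<Sum>n\<in>S. \<bar>n\<bar>)" by (intro sum.cong) (auto simp: c_def abs_mult)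
    finally have "\<bar>z\<bar> < int Q" using assms(3) by simp
    with \<open>z \<noteq> 0\<close> have "\<not> int Q dvd z" using dvd_imp_le_int[of z "int Q"] by auto
    have *: "(\<Sum>n\<in>S. \<sigma> n * (2 * pi * of_int n * x + \<phi> n))
        = 2 * pi * of_int z * x + (\<Sum>n\<in>S. \<sigma> n * \<phi> n)" for x
    proof -
      have "of_int z = (\<Sum>n\<in>S. \<sigma> n * of_int n)" by (simp add: z_def c)
      then have "2 * pi * of_int z * x = (\<Sum>n\<in>S. 2 * pi * x * (\<sigma> n * of_int n))"
        by (simp add: sum_distrib_left sum_distrib_right mult_ac)
      then show ?thesis
        by (simp add: sum.distrib[symmetric]) (simp add: algebra_simps)
    qed
    have "Q > 0" using \<open>\<bar>z\<bar> < int Q\<close> by linarith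
    then show "(\<Sum>k<Q. cos (\<Sum>n\<in>S. \<sigma> n * (2 * pi * of_int n * (real k / real Q) + \<phi> n))) = 0"
      unfolding * by (rule sum_cos_grid_eq_0) fact
  qed
  finally show ?thesis using assms(1) by (simp add: sign_mean_const)
qed

section \<open>Random Riesz products\<close>

text \<open>Pairing with a Riesz product reads off its Walsh coefficients of order one.\<close>

lemma sign_mean_coord_prod:
  assumes "finite A" "B \<subseteq> A" "n \<in> A"
  shows "sign_mean A (\<lambda>\<epsilon>. \<epsilon> n * (\<Prod>m\<in>B. 1 + \<epsilon> m * u m)) = (if n \<in> B then u n else 0)"
proof -
  \<comment> \<open>Padding by zeros gives one factor for each element of \<open>A\<close>, as
    \<open>sign_mean_prod\<close> requires.\<close>
  define v where "v = (\<lambda>m. if m \<in> B then u m else 0)"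
  have *: "\<epsilon> n * (\<Prod>m\<in>B. 1 + \<epsilon> m * u m) = (\<Prod>m\<in>A. (if m = n then \<epsilon> m else 1) * (1 + \<epsilon> m * v m))" for \<epsilon>
  proof -
    have "(\<Prod>m\<in>A. 1 + \<epsilon> m * v m) = (\<Prod>m\<in>B. 1 + \<epsilon> m * u m)"
      using assms by (intro prod.mono_neutral_cong_right) (auto simp: v_def)
    then show ?thesis using assms by (simp add: prod.distrib)
  qed
  have "sign_mean A (\<lambda>\<epsilon>. \<epsilon> n * (\<Prod>m\<in>B. 1 + \<epsilon> m * u m)) = (\<Prod>m\<in>A. if m = n then v m else 1)"
    unfolding * by (subst sign_mean_prod[OF assms(1)]) (intro prod.cong, auto simp: field_simps)
  also have "\<dots> = v n" using assms by simp
  finally show ?thesis by (simp add: v_def)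
qed

text \<open>Parseval for the Walsh expansion of the grid mean of a Riesz product. The square is
  written as a double sum over grid points; independence turns each summand into a product, and
  expanding that product over subsets makes the double sum a square again.\<close>

lemma sign_mean_riesz_square:
  fixes c :: "'i \<Rightarrow> nat \<Rightarrow> real"
  assumes "finite B"
  shows "sign_mean B (\<lambda>\<epsilon>. ((\<Sum>k<Q. \<Prod>n\<in>B. 1 + \<epsilon> n * (\<theta> * c n k)) / real Q)\<^sup>2)
       = (\<Sum>S\<in>Pow B. (\<theta>\<^sup>2) ^ card S * ((\<Sum>k<Q. \<Prod>n\<in>S. c n k) / real Q)\<^sup>2)"
proof -
  have "sign_mean B (\<lambda>\<epsilon>. ((\<Sum>k<Q. \<Prod>n\<in>B. 1 + \<epsilon> n * (\<theta> * c n k)) / real Q)\<^sup>2)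
     = sign_mean B (\<lambda>\<epsilon>. (1 / (real Q)\<^sup>2) * (\<Sum>k<Q. \<Sum>l<Q.
          \<Prod>n\<in>B. (1 + \<epsilon> n * (\<theta> * c n k)) * (1 + \<epsilon> n * (\<theta> * c n l))))"
    by (intro sign_mean_cong) (simp add: power_divide power2_eq_square sum_product prod.distrib)
  also have "\<dots> = (1 / (real Q)\<^sup>2) * (\<Sum>k<Q. \<Sum>l<Q. \<Prod>n\<in>B. 1 + \<theta>\<^sup>2 * (c n k * c n l))"
  proof -
    have "sign_mean B (\<lambda>\<epsilon>. \<Prod>n\<in>B. (1 + \<epsilon> n * (\<theta> * c n k)) * (1 + \<epsilon> n * (\<theta> * c n l)))
       = (\<Prod>n\<in>B. 1 + \<theta>\<^sup>2 * (c n k * c n l))" for k l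
      by (subst sign_mean_prod[OF assms])
        (intro prod.cong, auto simp: field_simps power2_eq_square)
    then show ?thesis by (simp only: sign_mean_cmult sign_mean_sum)
  qed
  also have "(\<Sum>k<Q. \<Sum>l<Q. \<Prod>n\<in>B. 1 + \<theta>\<^sup>2 * (c n k * c n l))
     = (\<Sum>k<Q. \<Sum>l<Q. \<Sum>S\<in>Pow B. (\<theta>\<^sup>2) ^ card S * ((\<Prod>n\<in>S. c n k) * (\<Prod>n\<in>S. c n l)))"
    using prod_add[OF assms, of "\<lambda>n. \<theta>\<^sup>2 * (c n _ * c n _)" "\<lambda>_. 1"]
    by (simp add: prod.distrib add.commute)
  also have "\<dots> = (\<Sum>S\<in>Pow B. (\<theta>\<^sup>2) ^ card S * (\<Sum>k<Q. \<Prod>n\<in>S. c n k)\<^sup>2)"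
  proof -
    have "(\<Sum>k<Q. \<Sum>l<Q. \<Sum>S\<in>Pow B. f k l S) = (\<Sum>S\<in>Pow B. \<Sum>k<Q. \<Sum>l<Q. f k l S)"
      for f :: "nat \<Rightarrow> nat \<Rightarrow> 'i set \<Rightarrow> real"
      by (rule trans[OF sum.cong[OF refl sum.swap] sum.swap])
    then show ?thesis
      by (simp add: power2_eq_square sum_product) (simp only: sum_distrib_left)
  qed
  finally show ?thesis
    by (simp add: sum_distrib_left power_divide mult_ac)
qed

text \<open>In the expansion over \<open>S\<close> the empty set contributes at most 1, and nonempty
  sets with fewer than \<open>s\<close> elements contribute 0. For the remaining ones the factor exp
  (card S - s), which is at least 1, may be inserted; the sum over all subsets is then at most
  \<open>exp (- s) * (1 + exp 1 * \<theta>\<^sup>2) ^ card B \<le> 1\<close>. This dictates the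
  choice of \<theta>.\<close>

lemma riesz_square_le_2:
  fixes s :: real and \<phi> :: "int \<Rightarrow> real"
  assumes "finite B" "B \<noteq> {}" and Q: "(\<Sum>n\<in>B. \<bar>n\<bar>) < int Q"
    and "s > 0" and \<theta>: "\<theta>\<^sup>2 = s / (exp 1 * card B)"
    and free: "\<And>S. S \<subseteq> B \<Longrightarrow> S \<noteq> {} \<Longrightarrow> card S < s \<Longrightarrow> relation_free S"
  shows "sign_mean B (\<lambda>\<epsilon>. ((\<Sum>k<Q. \<Prod>n\<in>B. 1 + \<epsilon> n * (\<theta> * cos (2 * pi * of_int n * (real k / real Q) + \<phi> n)))
            / real Q)\<^sup>2) \<le> 2"
proof -
  define w where "w = (\<lambda>S. (\<Sum>k<Q. \<Prod>n\<in>S. cos (2 * pi * of_int n * (real k / real Q) + \<phi> n)) / real Q)"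
  have "0 \<le> (\<Sum>n\<in>B. \<bar>n\<bar>)" by (intro sum_nonneg) auto
  with Q have "Q > 0" by linarith
  have w_le: "(w S)\<^sup>2 \<le> 1" for S
  proof -
    have "\<bar>\<Sum>k<Q. \<Prod>n\<in>S. cos (2 * pi * of_int n * (real k / real Q) + \<phi> n)\<bar> \<le> (\<Sum>k<Q. 1)"
      by (intro order_trans[OF sum_abs] sum_mono) (auto simp: abs_prod intro!: prod_le_1)
    then have "\<bar>w S\<bar> \<le> 1" using \<open>Q > 0\<close> by (simp add: w_def abs_divide)
    then show ?thesis by (simp add: abs_square_le_1)
  qed
  have w0: "w S = 0" if "S \<subseteq> B" "S \<noteq> {}" "card S < s" for S
  proof -
    have "(\<Sum>n\<in>S. \<bar>n\<bar>) \<le> (\<Sum>n\<in>B. \<bar>n\<bar>)" using that assms by (intro sum_mono2) auto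
    then show ?thesis
      using sum_prod_cos_grid_eq_0[of S Q \<phi>] free[OF that] that Q finite_subset[OF that(1) assms(1)]
      by (simp add: w_def)
  qed
  have bound: "(\<theta>\<^sup>2) ^ card S * (w S)\<^sup>2 \<le> (if S = {} then 1 else 0) + exp (-s) * (exp 1 * \<theta>\<^sup>2) ^ card S"
    if "S \<subseteq> B" for S
  proof (cases "S = {}")
    case True
    then show ?thesis using w_le[of "{}"] by (simp add: add_increasing2)
  next
    case False
    show ?thesis
    proof (cases "card S < s")
      case True
      then show ?thesis using w0 False that by simp
    next
      case False2: False
      have "1 \<le> exp (real (card S) - s)" using False2 by simp
      also have "\<dots> = exp (-s) * exp 1 ^ card S"
        by (simp add: exp_diff exp_minus exp_of_nat_mult[of "card S" 1, simplified] field_simps)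
      finally have "(\<theta>\<^sup>2) ^ card S * 1 \<le> (\<theta>\<^sup>2) ^ card S * (exp (-s) * exp 1 ^ card S)"
        by (intro mult_left_mono) auto
      moreover have "(\<theta>\<^sup>2) ^ card S * (w S)\<^sup>2 \<le> (\<theta>\<^sup>2) ^ card S * 1"
        by (intro mult_left_mono w_le) auto
      ultimately show ?thesis using False by (simp add: power_mult_distrib mult_ac)
    qed
  qed
  have "(\<Sum>S\<in>Pow B. (exp 1 * \<theta>\<^sup>2) ^ card S) = (1 + exp 1 * \<theta>\<^sup>2) ^ card B"
    using prod_add[OF assms(1), of "\<lambda>_. exp 1 * \<theta>\<^sup>2" "\<lambda>_. 1"] by (simp add: add.commute)
  also have "\<dots> \<le> exp (exp 1 * \<theta>\<^sup>2) ^ card B"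
    by (intro power_mono exp_ge_add_one_self) auto
  also have "\<dots> = exp s"
    using assms by (simp add: exp_of_nat_mult[symmetric] \<theta>)
  finally have pow: "(\<Sum>S\<in>Pow B. (exp 1 * \<theta>\<^sup>2) ^ card S) \<le> exp s" .
  have "(\<Sum>S\<in>Pow B. (\<theta>\<^sup>2) ^ card S * (w S)\<^sup>2)
      \<le> (\<Sum>S\<in>Pow B. (if S = {} then 1 else 0) + exp (-s) * (exp 1 * \<theta>\<^sup>2) ^ card S)"
    by (intro sum_mono bound) auto
  also have "\<dots> = 1 + exp (-s) * (\<Sum>S\<in>Pow B. (exp 1 * \<theta>\<^sup>2) ^ card S)"
    using assms(1) by (simp add: sum.distrib sum_distrib_left)
  also have "\<dots> \<le> 1 + exp (-s) * exp s"
    by (intro add_left_mono mult_left_mono pow) auto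
  finally have "(\<Sum>S\<in>Pow B. (\<theta>\<^sup>2) ^ card S * (w S)\<^sup>2) \<le> 2"
    by (simp add: exp_minus)
  then show ?thesis
    unfolding sign_mean_riesz_square[OF assms(1)] w_def .
qed

text \<open>Three properties of the random sup norm enter: it majorises the polynomial, a flip of
  one sign changes it by at most \<open>2 * norm (a i)\<close>, and its mean dominates the l2 norm
  of the coefficients. The last two bound its second moment by twice the square of its mean, in
  place of a Kahane inequality.\<close>

theorem sum_norm_le_sign_mean:
  fixes A B :: "int set" and a :: "int \<Rightarrow> complex" and N :: "(int \<Rightarrow> real) \<Rightarrow> real" and s :: real
  assumes "finite A" "B \<subseteq> A" "0 \<notin> B"
    and N: "\<And>\<epsilon> x. norm (\<Sum>n\<in>A. of_real (\<epsilon> n) * a n * char_fn n x) \<le> N \<epsilon>"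
    and lip: "\<And>\<epsilon> i. i \<in> A \<Longrightarrow> \<bar>N (\<epsilon>(i := 1)) - N (\<epsilon>(i := -1))\<bar> \<le> 2 * norm (a i)"
    and l2: "sqrt (\<Sum>n\<in>A. (norm (a n))\<^sup>2) \<le> sign_mean A N"
    and s: "s > 0" "s \<le> card B"
    and free: "\<And>S. S \<subseteq> B \<Longrightarrow> S \<noteq> {} \<Longrightarrow> card S < s \<Longrightarrow> relation_free S"
  shows "(\<Sum>n\<in>B. norm (a n)) \<le> 4 * sqrt (exp 1 * card B / s) * sign_mean A N"
\<comment> \<open>A vanishing mean forces all coefficients to vanish, by \<open>l2\<close>;
  otherwise one may divide by the mean.\<close>
proof (cases "sign_mean A N = 0")
  case True
  then have "(\<Sum>n\<in>A. (norm (a n))\<^sup>2) = 0"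
    using l2 by (metis order_antisym real_sqrt_ge_zero real_sqrt_eq_zero_cancel_iff sum_nonneg zero_le_power2)
  then have "norm (a n) = 0" if "n \<in> A" for n
    using that assms(1) by (simp add: sum_nonneg_eq_0_iff)
  then have "(\<Sum>n\<in>B. norm (a n)) = 0" using assms(2) by (intro sum.neutral) auto
  then show ?thesis using True by simp
next
  case False
  define R where "R = sign_mean A N"
  have l2': "(\<Sum>n\<in>A. (norm (a n))\<^sup>2) \<le> R\<^sup>2"
    using l2 by (simp add: R_def sqrt_le_D)
  have "0 \<le> sqrt (\<Sum>n\<in>A. (norm (a n))\<^sup>2)" by (simp add: sum_nonneg)
  then have "R > 0" using l2 False unfolding R_def by linarith
  have finB: "finite B" using assms(1,2) by (rule rev_finite_subset)
  have "B \<noteq> {}" using s by auto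
  define m where "m = real (card B)"
  have "m > 0" using s by (simp add: m_def)
  \<comment> \<open>The value required by \<open>riesz_square_le_2\<close>. Since
    \<open>s \<le> card B\<close>, it is at most 1, which keeps the Riesz product
    nonnegative.\<close>
  define \<theta> where "\<theta> = sqrt (s / (exp 1 * m))"
  have \<theta>2: "\<theta>\<^sup>2 = s / (exp 1 * card B)"
    using \<open>m > 0\<close> s by (simp add: \<theta>_def m_def)
  have "\<theta> > 0" using \<open>m > 0\<close> s by (simp add: \<theta>_def)
  have "1 * m \<le> exp 1 * m" using \<open>m > 0\<close> by (intro mult_right_mono) auto
  then have "s \<le> exp 1 * m" using s unfolding m_def by linarith
  then have "\<theta> \<le> 1" using \<open>m > 0\<close> by (simp add: \<theta>_def)
  \<comment> \<open>So large that \<open>Q\<close> exceeds every signed sum over a subset of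
    \<open>B\<close> and also \<open>2 * \<bar>n\<bar>\<close> for each \<open>n \<in> B\<close>;
    the latter gives the mean 1/2 for the squared cosines.\<close>
  define Q where "Q = nat (2 * (\<Sum>n\<in>B. \<bar>n\<bar>) + 1)"
  have sum0: "0 \<le> (\<Sum>n\<in>B. \<bar>n\<bar>)" by (intro sum_nonneg) auto
  then have Q: "int Q = 2 * (\<Sum>n\<in>B. \<bar>n\<bar>) + 1" by (simp add: Q_def)
  then have "Q > 0" using sum0 by linarith
  \<comment> \<open>With this phase the real part of each term of the polynomial is
    \<open>norm (a n)\<close> times the same cosine that occurs in the Riesz product.\<close>
  define \<phi> where "\<phi> = (\<lambda>n. Arg (a n))"
  define x where "x = (\<lambda>k. real k / real Q)"
  define c where "c = (\<lambda>n k. cos (2 * pi * of_int n * x k + \<phi> n))"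
  define P where "P = (\<lambda>\<epsilon> k. \<Prod>n\<in>B. 1 + \<epsilon> n * (\<theta> * c n k))"
  define Mz where "Mz = (\<lambda>\<epsilon>. (\<Sum>k<Q. P \<epsilon> k) / real Q)"

  have Re_term: "Re (of_real e * a n * char_fn n y) = e * (norm (a n) * cos (2 * pi * of_int n * y + \<phi> n))" for e n y
  proof -
    have "a n = of_real (norm (a n)) * cis (\<phi> n)"
      by (simp add: \<phi>_def rcis_cmod_Arg[unfolded rcis_def])
    then have eq: "of_real e * a n * char_fn n y = of_real (e * norm (a n)) * cis (2 * pi * of_int n * y + \<phi> n)"
      by (metis (no_types, lifting) ab_semigroup_mult_class.mult_ac(1) add.commute char_fn_cis cis_mult of_real_mult)
    show ?thesis unfolding eq by simp
  qed
  have P_nonneg: "P \<epsilon> k \<ge> 0" if "\<epsilon> \<in> A \<rightarrow>\<^sub>E {-1, 1}" for \<epsilon> k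
    unfolding P_def
  proof (rule prod_nonneg)
    fix n assume "n \<in> B"
    with assms(2) have "n \<in> A" by auto
    then have "\<bar>\<epsilon> n\<bar> = 1" using PiE_mem[OF that, of n] by auto
    moreover have "\<bar>\<theta> * c n k\<bar> \<le> 1"
      using \<open>\<theta> > 0\<close> \<open>\<theta> \<le> 1\<close> by (simp add: abs_mult c_def mult_le_one)
    ultimately have "\<bar>\<epsilon> n * (\<theta> * c n k)\<bar> \<le> 1" by (simp only: abs_mult)
    then show "0 \<le> 1 + \<epsilon> n * (\<theta> * c n k)" by linarith
  qed

  \<comment> \<open>Averaging over the signs leaves only the frequencies in \<open>B\<close>, each
    contributing \<open>norm (a n) * \<theta>\<close> times the grid mean 1/2 of a squared cosine.
    Since the Riesz product is nonnegative, the real part of the polynomial may then be replaced by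
    its bound \<open>N\<close>.\<close>
  have lower: "\<theta> / 2 * (\<Sum>n\<in>B. norm (a n)) \<le> sign_mean A (\<lambda>\<epsilon>. N \<epsilon> * Mz \<epsilon>)"
  proof -
    have c2: "(\<Sum>k<Q. (c n k)\<^sup>2) = real Q / 2" if "n \<in> B" for n
    proof -
      have "\<bar>n\<bar> \<le> (\<Sum>n\<in>B. \<bar>n\<bar>)" using that finB by (intro member_le_sum) auto
      moreover have "n \<noteq> 0" using that assms(3) by auto
      ultimately have "\<not> int Q dvd 2 * n" using Q dvd_imp_le_int[of "2 * n" "int Q"] by auto
      then show ?thesis using sum_cos_square_grid[of Q n "\<phi> n"] \<open>Q > 0\<close> by (simp add: c_def x_def)
    qed
    have "\<theta> / 2 * (\<Sum>n\<in>B. norm (a n)) = (\<Sum>n\<in>B. norm (a n) * \<theta> * (real Q / 2)) / real Q"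
      using \<open>Q > 0\<close> by (simp add: sum_distrib_left sum_divide_distrib mult_ac)
    also have "(\<Sum>n\<in>B. norm (a n) * \<theta> * (real Q / 2)) = (\<Sum>n\<in>B. \<Sum>k<Q. norm (a n) * c n k * (\<theta> * c n k))"
      by (intro sum.cong refl) (simp add: c2[symmetric] sum_distrib_left power2_eq_square mult_ac)
    also have "\<dots> = (\<Sum>k<Q. \<Sum>n\<in>B. norm (a n) * c n k * (\<theta> * c n k))" by (rule sum.swap)
    also have "\<dots> = (\<Sum>k<Q. \<Sum>n\<in>A. norm (a n) * c n k * (if n \<in> B then \<theta> * c n k else 0))"
      using assms(1,2) by (intro sum.cong refl sum.mono_neutral_cong_left) auto
    also have "\<dots> = (\<Sum>k<Q. \<Sum>n\<in>A. sign_mean A (\<lambda>\<epsilon>. norm (a n) * c n k * (\<epsilon> n * P \<epsilon> k)))"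
      unfolding P_def using assms(1,2) by (simp add: sign_mean_cmult sign_mean_coord_prod)
    also have "\<dots> = sign_mean A (\<lambda>\<epsilon>. \<Sum>k<Q. (\<Sum>n\<in>A. \<epsilon> n * (norm (a n) * c n k)) * P \<epsilon> k)"
      unfolding sign_mean_sum[symmetric] sum_distrib_right by (simp add: mult_ac)
    also have "\<dots> / real Q = sign_mean A (\<lambda>\<epsilon>. (\<Sum>k<Q. (\<Sum>n\<in>A. \<epsilon> n * (norm (a n) * c n k)) * P \<epsilon> k) / real Q)"
      using sign_mean_cmult[of A "1 / real Q"] by simp
    also have "\<dots> \<le> sign_mean A (\<lambda>\<epsilon>. N \<epsilon> * Mz \<epsilon>)"
    proof (rule sign_mean_mono)
      fix \<epsilon> assume \<epsilon>: "\<epsilon> \<in> A \<rightarrow>\<^sub>E {-1, 1::real}"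
      have "(\<Sum>n\<in>A. \<epsilon> n * (norm (a n) * c n k)) \<le> N \<epsilon>" for k
      proof -
        have "(\<Sum>n\<in>A. \<epsilon> n * (norm (a n) * c n k)) = Re (\<Sum>n\<in>A. of_real (\<epsilon> n) * a n * char_fn n (x k))"
          by (simp only: Re_sum Re_term c_def)
        also have "\<dots> \<le> N \<epsilon>" by (rule order_trans[OF complex_Re_le_cmod N])
        finally show ?thesis .
      qed
      then have "(\<Sum>k<Q. (\<Sum>n\<in>A. \<epsilon> n * (norm (a n) * c n k)) * P \<epsilon> k) \<le> (\<Sum>k<Q. N \<epsilon> * P \<epsilon> k)"
        by (intro sum_mono mult_right_mono P_nonneg[OF \<epsilon>]) auto
      then show "(\<Sum>k<Q. (\<Sum>n\<in>A. \<epsilon> n * (norm (a n) * c n k)) * P \<epsilon> k) / real Q \<le> N \<epsilon> * Mz \<epsilon>"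
        by (simp add: Mz_def sum_distrib_left divide_right_mono)
    qed
    finally show ?thesis .
  qed

  have "sign_mean A (\<lambda>\<epsilon>. (Mz \<epsilon>)\<^sup>2) = sign_mean B (\<lambda>\<epsilon>. (Mz \<epsilon>)\<^sup>2)"
    using assms(1,2) by (rule sign_mean_restrict) (simp add: Mz_def P_def)
  also have "\<dots> \<le> 2"
    unfolding Mz_def P_def c_def x_def
    by (rule riesz_square_le_2[OF finB \<open>B \<noteq> {}\<close> _ s(1) \<theta>2 free]) (use Q sum0 in auto)
  finally have M2: "sign_mean A (\<lambda>\<epsilon>. (Mz \<epsilon>)\<^sup>2) \<le> 2" .
  have "sign_mean A (\<lambda>\<epsilon>. (N \<epsilon>)\<^sup>2) \<le> R\<^sup>2 + (\<Sum>n\<in>A. (norm (a n))\<^sup>2)"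
    unfolding R_def by (rule sign_mean_square_le[OF assms(1) lip])
  then have N2: "sign_mean A (\<lambda>\<epsilon>. (N \<epsilon>)\<^sup>2) \<le> 2 * R\<^sup>2" using l2' by simp
  \<comment> \<open>The inequality between arithmetic and geometric means stands in for
    Cauchy-Schwarz; the weights are such that each of the two terms has mean at most
    \<open>R\<close>.\<close>
  have "sign_mean A (\<lambda>\<epsilon>. N \<epsilon> * Mz \<epsilon>) \<le> sign_mean A (\<lambda>\<epsilon>. 1 / (2 * R) * (N \<epsilon>)\<^sup>2 + R / 2 * (Mz \<epsilon>)\<^sup>2)"
  proof (rule sign_mean_mono)
    fix \<epsilon>
    have "0 \<le> (N \<epsilon> - R * Mz \<epsilon>)\<^sup>2 / (2 * R)" using \<open>R > 0\<close> by simp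
    also have "\<dots> = 1 / (2 * R) * (N \<epsilon>)\<^sup>2 + R / 2 * (Mz \<epsilon>)\<^sup>2 - N \<epsilon> * Mz \<epsilon>"
      using \<open>R > 0\<close> by (simp add: power2_eq_square field_simps)
    finally show "N \<epsilon> * Mz \<epsilon> \<le> 1 / (2 * R) * (N \<epsilon>)\<^sup>2 + R / 2 * (Mz \<epsilon>)\<^sup>2" by simp
  qed
  also have "\<dots> = 1 / (2 * R) * sign_mean A (\<lambda>\<epsilon>. (N \<epsilon>)\<^sup>2) + R / 2 * sign_mean A (\<lambda>\<epsilon>. (Mz \<epsilon>)\<^sup>2)"
    by (simp only: sign_mean_add sign_mean_cmult)
  also have "\<dots> \<le> 1 / (2 * R) * (2 * R\<^sup>2) + R / 2 * 2"
    using \<open>R > 0\<close> M2 N2 by (intro add_mono mult_left_mono) auto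
  also have "\<dots> = 2 * R" using \<open>R > 0\<close> by (simp add: power2_eq_square)
  finally have "\<theta> / 2 * (\<Sum>n\<in>B. norm (a n)) \<le> 2 * R" using lower by simp
  then have "(\<Sum>n\<in>B. norm (a n)) \<le> 4 * (1 / \<theta>) * R" using \<open>\<theta> > 0\<close> by (simp add: field_simps)
  also have "1 / \<theta> = sqrt (exp 1 * card B / s)"
    using s by (simp add: \<theta>_def m_def real_sqrt_divide)
  finally show ?thesis by (simp add: R_def)
qed

section \<open>The random sup norm\<close>

lemma sup_norm_upper:
  assumes "\<And>x. norm (F x) \<le> K"
  shows "norm (F x) \<le> sup_norm F"
  unfolding sup_norm_def by (rule cSUP_upper) (use assms in \<open>auto intro!: bdd_aboveI2\<close>)

lemma sup_norm_least:
  assumes "\<And>x. norm (F x) \<le> K"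
  shows "sup_norm F \<le> K"
  unfolding sup_norm_def by (rule cSUP_least) (use assms in auto)

text \<open>Continuity reduces the supremum to a countable dense set, which makes the random sup
  norm measurable in the signs.\<close>

lemma sup_norm_eq_SUP_Rats:
  assumes "continuous_on UNIV F" and "\<And>x. norm (F x) \<le> K"
  shows "sup_norm F = (SUP x\<in>\<rat>. norm (F x))"
proof (rule antisym)
  have bdd: "bdd_above ((\<lambda>x. norm (F x)) ` \<rat>)" using assms(2) by (auto intro!: bdd_aboveI2)
  have "norm (F x) \<le> (SUP x\<in>\<rat>. norm (F x))" for x
  proof -
    have "closed {x. norm (F x) \<le> (SUP x\<in>\<rat>. norm (F x))}"
      by (intro closed_Collect_le continuous_on_norm assms(1) continuous_on_const)
    moreover have "\<rat> \<subseteq> {x. norm (F x) \<le> (SUP x\<in>\<rat>. norm (F x))}"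
      by (auto intro: cSUP_upper[OF _ bdd])
    ultimately have "closure \<rat> \<subseteq> {x. norm (F x) \<le> (SUP x\<in>\<rat>. norm (F x))}"
      by (rule closure_minimal[rotated])
    then show ?thesis using Rats_closure_real by auto
  qed
  then show "sup_norm F \<le> (SUP x\<in>\<rat>. norm (F x))" by (rule sup_norm_least)
  show "(SUP x\<in>\<rat>. norm (F x)) \<le> sup_norm F"
    by (rule cSUP_least) (use sup_norm_upper[OF assms(2)] in auto)
qed

definition rand_sup :: "int set \<Rightarrow> (int \<Rightarrow> complex) \<Rightarrow> (int \<Rightarrow> real) \<Rightarrow> real" where
  "rand_sup A a \<epsilon> = sup_norm (\<lambda>x. \<Sum>n\<in>A. of_real (\<epsilon> n) * a n * char_fn n x)"

lemma norm_signed_poly_le: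
  "norm (\<Sum>n\<in>A. of_real (\<epsilon> n) * a n * char_fn n x) \<le> (\<Sum>n\<in>A. \<bar>\<epsilon> n\<bar> * norm (a n))"
  by (rule order_trans[OF norm_sum]) (simp add: norm_mult)

lemma norm_le_rand_sup: "norm (\<Sum>n\<in>A. of_real (\<epsilon> n) * a n * char_fn n x) \<le> rand_sup A a \<epsilon>"
  unfolding rand_sup_def by (rule sup_norm_upper[OF norm_signed_poly_le])

text \<open>Only the term of index \<open>i\<close> changes, and by a function of sup norm
  \<open>2 * norm (a i)\<close>.\<close>

lemma rand_sup_flip:
  assumes "finite A" "i \<in> A"
  shows "\<bar>rand_sup A a (\<epsilon>(i := 1)) - rand_sup A a (\<epsilon>(i := -1))\<bar> \<le> 2 * norm (a i)"
proof -
  have "rand_sup A a (\<epsilon>(i := u)) \<le> rand_sup A a (\<epsilon>(i := v)) + \<bar>u - v\<bar> * norm (a i)" for u v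
    unfolding rand_sup_def[of _ _ "\<epsilon>(i := u)"]
  proof (rule sup_norm_least)
    fix x
    have eq: "(\<Sum>n\<in>A. of_real ((\<epsilon>(i := w)) n) * a n * char_fn n x)
        = of_real w * a i * char_fn i x + (\<Sum>n\<in>A - {i}. of_real (\<epsilon> n) * a n * char_fn n x)" for w
      using assms by (subst sum.remove[of _ i]) (auto intro!: sum.cong)
    have "(\<Sum>n\<in>A. of_real ((\<epsilon>(i := u)) n) * a n * char_fn n x)
        = (\<Sum>n\<in>A. of_real ((\<epsilon>(i := v)) n) * a n * char_fn n x) + of_real (u - v) * a i * char_fn i x"
      unfolding eq by (simp add: algebra_simps)
    also have "norm \<dots> \<le> rand_sup A a (\<epsilon>(i := v)) + \<bar>u - v\<bar> * norm (a i)"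
      by (intro order_trans[OF norm_triangle_ineq] add_mono norm_le_rand_sup)
        (simp add: norm_mult del: of_real_diff)
    finally show "norm (\<Sum>n\<in>A. of_real ((\<epsilon>(i := u)) n) * a n * char_fn n x)
        \<le> rand_sup A a (\<epsilon>(i := v)) + \<bar>u - v\<bar> * norm (a i)" .
  qed
  from this[of 1 "-1"] this[of "-1" 1] show ?thesis by simp
qed

section \<open>Fourier coefficients and Parseval's inequality\<close>

lemma continuous_on_char_fn [continuous_intros]: "continuous_on S (char_fn n)"
  unfolding char_fn_def[abs_def] by (intro continuous_intros)

lemma has_integral_char_fn:
  "(char_fn k has_integral (if k = 0 then 1 else 0)) {0..1}"
proof (cases "k = 0")
  case True
  then have "char_fn k = (\<lambda>x. 1)" by (simp add: char_fn_def fun_eq_iff)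
  then show ?thesis using True has_integral_const_real[of "1::complex" 0 1] by simp
next
  case False
  define g where "g = (\<lambda>x. char_fn k x / (2 * of_real pi * \<i> * of_int k))"
  have "(g has_vector_derivative char_fn k x) (at x within {0..1})" for x
    unfolding g_def char_fn_def[abs_def] using False
    by (auto intro!: derivative_eq_intros has_vector_derivative_real_field simp: field_simps)
  then have "(char_fn k has_integral (g 1 - g 0)) {0..1}"
    by (intro fundamental_theorem_of_calculus) auto
  moreover have "g 1 = g 0"
    using cis_multiple_2pi[of "of_int k"] by (simp add: g_def char_fn_cis)
  ultimately show ?thesis using False by simp
qed

lemma char_fn_mult: "char_fn n x * char_fn m x = char_fn (n + m) x"
  by (simp add: char_fn_def exp_add[symmetric] algebra_simps)

lemma cnj_char_fn: "cnj (char_fn n x) = char_fn (- n) x"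
  by (simp add: char_fn_cis cis_cnj)

lemma fourier_coeff_poly:
  assumes "finite A"
  shows "fourier_coeff (\<lambda>x. \<Sum>n\<in>A. c n * char_fn n x) m = (if m \<in> A then c m else 0)"
proof -
  have "((\<lambda>x. \<Sum>n\<in>A. c n * char_fn (n - m) x) has_integral (\<Sum>n\<in>A. c n * (if n - m = 0 then 1 else 0))) {0..1}"
    by (intro has_integral_sum assms has_integral_mult_right has_integral_char_fn)
  moreover have "(\<Sum>n\<in>A. c n * (if n - m = 0 then 1 else 0)) = (if m \<in> A then c m else 0)"
    using assms by (simp add: if_distrib cong: if_cong)
  moreover have "(\<Sum>n\<in>A. c n * char_fn n x) * char_fn (- m) x = (\<Sum>n\<in>A. c n * char_fn (n - m) x)" for x
    by (simp add: sum_distrib_right mult.assoc char_fn_mult)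
  ultimately show ?thesis
    unfolding fourier_coeff_def by (simp add: integral_unique)
qed

lemma parseval_le_sup:
  assumes "finite A" and K: "\<And>x. norm (\<Sum>n\<in>A. b n * char_fn n x) \<le> K"
  shows "(\<Sum>n\<in>A. (norm (b n))\<^sup>2) \<le> K\<^sup>2"
proof -
  define F where "F x = (\<Sum>n\<in>A. b n * char_fn n x)" for x
  have "((\<lambda>x. \<Sum>n\<in>A. \<Sum>m\<in>A. (b n * cnj (b m)) * char_fn (n - m) x) has_integral
      (\<Sum>n\<in>A. \<Sum>m\<in>A. (b n * cnj (b m)) * (if n - m = 0 then 1 else 0))) {0..1}"
    by (intro has_integral_sum assms has_integral_mult_right has_integral_char_fn)
  moreover have "(\<Sum>n\<in>A. \<Sum>m\<in>A. (b n * cnj (b m)) * char_fn (n - m) x) = F x * cnj (F x)" for x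
  proof -
    have *: "(b n * cnj (b m)) * char_fn (n - m) x = (b n * char_fn n x) * cnj (b m * char_fn m x)" for n m
      using char_fn_mult[of n x "- m"] by (simp add: cnj_char_fn mult_ac)
    show ?thesis unfolding F_def cnj_sum sum_product * ..
  qed
  moreover have "(\<Sum>n\<in>A. \<Sum>m\<in>A. (b n * cnj (b m)) * (if n - m = 0 then 1 else 0)) = of_real (\<Sum>n\<in>A. (norm (b n))\<^sup>2)"
    unfolding of_real_sum complex_norm_square using assms(1) by (simp add: if_distrib cong: if_cong)
  ultimately have "((\<lambda>x. F x * cnj (F x)) has_integral of_real (\<Sum>n\<in>A. (norm (b n))\<^sup>2)) (cbox 0 1)"
    by (simp add: cbox_interval)
  moreover have "norm (F x * cnj (F x)) \<le> K\<^sup>2" for x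
    using power_mono[of "norm (F x)" K 2] K[of x, folded F_def] by (simp add: norm_mult power2_eq_square)
  ultimately have "norm (of_real (\<Sum>n\<in>A. (norm (b n))\<^sup>2) :: complex) \<le> K\<^sup>2 * measure lborel (cbox 0 (1::real))"
    by (intro has_integral_bound[of "K\<^sup>2"]) auto
  then show ?thesis by (simp add: sum_nonneg del: of_real_sum of_real_power)
qed

lemma rand_sup_nonneg: "0 \<le> rand_sup A a \<epsilon>"
  using norm_le_rand_sup order_trans norm_ge_zero by blast

text \<open>The bound holds for every single choice of signs, by Parseval, because signs do not
  change the moduli of the coefficients.\<close>

lemma l2_le_sign_mean_rand_sup:
  assumes "finite A"
  shows "sqrt (\<Sum>n\<in>A. (norm (a n))\<^sup>2) \<le> sign_mean A (rand_sup A a)"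
proof -
  have "sign_mean A (\<lambda>_. sqrt (\<Sum>n\<in>A. (norm (a n))\<^sup>2)) \<le> sign_mean A (rand_sup A a)"
  proof (rule sign_mean_mono)
    fix \<epsilon> assume \<epsilon>: "\<epsilon> \<in> A \<rightarrow>\<^sub>E {-1, 1::real}"
    have "norm (of_real (\<epsilon> n) * a n) = norm (a n)" if "n \<in> A" for n
      using PiE_mem[OF \<epsilon> that] by (auto simp: norm_mult)
    then have "(\<Sum>n\<in>A. (norm (a n))\<^sup>2) = (\<Sum>n\<in>A. (norm (of_real (\<epsilon> n) * a n))\<^sup>2)" by simp
    also have "\<dots> \<le> (rand_sup A a \<epsilon>)\<^sup>2"
      by (intro parseval_le_sup assms norm_le_rand_sup)
    finally show "sqrt (\<Sum>n\<in>A. (norm (a n))\<^sup>2) \<le> rand_sup A a \<epsilon>"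
      by (intro real_le_lsqrt) (auto simp: rand_sup_nonneg sum_nonneg)
  qed
  then show ?thesis by (simp add: sign_mean_const assms)
qed

section \<open>From the Rademacher law to finite sign averages\<close>

lemma rand_sup_measurable: "rand_sup A a \<in> borel_measurable rademacher_seq"
proof -
  have comp: "(\<lambda>\<epsilon>. \<epsilon> n) \<in> borel_measurable rademacher_seq" for n :: int
  proof -
    have "(\<lambda>\<epsilon>. \<epsilon> n) \<in> measurable rademacher_seq (measure_pmf (pmf_of_set {-1, 1}))"
      unfolding rademacher_seq_def by (rule measurable_component_singleton) simp
    then show ?thesis by (rule measurable_compose) simp
  qed
  have "rand_sup A a = (\<lambda>\<epsilon>. SUP x\<in>\<rat>. norm (\<Sum>n\<in>A. of_real (\<epsilon> n) * a n * char_fn n x))"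
    unfolding rand_sup_def[abs_def]
    by (intro ext sup_norm_eq_SUP_Rats[OF _ norm_signed_poly_le] continuous_intros)
  moreover have "\<dots> \<in> borel_measurable rademacher_seq"
  proof (rule borel_measurable_cSUP)
    show "(\<lambda>\<epsilon>. norm (\<Sum>n\<in>A. of_real (\<epsilon> n) * a n * char_fn n x)) \<in> borel_measurable rademacher_seq" for x
      using comp by measurable
  qed (auto simp: countable_rat intro!: bdd_aboveI2 norm_signed_poly_le)
  ultimately show ?thesis by simp
qed

text \<open>A functional of the coordinates in \<open>A\<close> is almost surely a simple function:
  it is constant on each cylinder \<open>E \<sigma>\<close>, and the cylinders of the sign patterns
  on \<open>A\<close> have probability \<open>1 / 2 ^ card A\<close> each.\<close>

lemma integral_rademacher_seq:
  assumes "finite A" and meas: "g \<in> borel_measurable rademacher_seq"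
    and dep: "\<And>\<epsilon> \<delta>. (\<And>n. n \<in> A \<Longrightarrow> \<epsilon> n = \<delta> n) \<Longrightarrow> g \<epsilon> = g \<delta>"
  shows "(LINT \<epsilon>|rademacher_seq. g \<epsilon>) = sign_mean A g"
proof -
  define D where "D = measure_pmf (pmf_of_set {-1, 1 :: real})"
  interpret D: prob_space D unfolding D_def by (rule prob_space_measure_pmf)
  interpret P: product_prob_space "\<lambda>_. D" UNIV ..
  have R: "rademacher_seq = PiM UNIV (\<lambda>_. D)" by (simp add: rademacher_seq_def D_def)
  define E where "E = (\<lambda>\<sigma>. {\<epsilon>. \<forall>n\<in>A. \<epsilon> n = \<sigma> n} :: (int \<Rightarrow> real) set)"
  have E_emb: "E \<sigma> = prod_emb UNIV (\<lambda>_. D) A (PiE A (\<lambda>n. {\<sigma> n}))" for \<sigma>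
    by (auto simp: E_def prod_emb_def D_def restrict_PiE_iff)
  have E_sets: "E \<sigma> \<in> sets rademacher_seq" for \<sigma>
    unfolding E_emb R using assms(1) by (intro sets_PiM_I) (auto simp: D_def)
  have E_measure: "measure rademacher_seq (E \<sigma>) = 1 / 2 ^ card A" if "\<sigma> \<in> A \<rightarrow>\<^sub>E {-1, 1}" for \<sigma>
  proof -
    have "measure rademacher_seq (E \<sigma>) = (\<Prod>n\<in>A. measure D {\<sigma> n})"
      unfolding E_emb R by (rule P.measure_PiM_emb) (use assms in \<open>auto simp: D_def\<close>)
    also have "\<dots> = (\<Prod>n\<in>A. 1 / 2)"
    proof (rule prod.cong[OF refl])
      fix n assume "n \<in> A"
      then have "\<sigma> n \<in> {-1, 1}" using that by (rule PiE_mem[rotated])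
      then show "measure D {\<sigma> n} = 1 / 2" by (auto simp: D_def measure_pmf_single)
    qed
    finally show ?thesis by (simp add: power_one_over)
  qed
  have AE1: "AE \<epsilon> in rademacher_seq. \<forall>n\<in>A. \<epsilon> n \<in> {-1, 1}"
    unfolding rademacher_seq_def
    by (intro AE_finite_allI assms AE_PiM_component) (auto simp: prob_space_measure_pmf AE_measure_pmf_iff)
  have "(LINT \<epsilon>|rademacher_seq. g \<epsilon>)
      = (LINT \<epsilon>|rademacher_seq. (\<Sum>\<sigma>\<in>A \<rightarrow>\<^sub>E {-1, 1}. g \<sigma> * indicator (E \<sigma>) \<epsilon>))"
  proof (rule integral_cong_AE)
    show "(\<lambda>\<epsilon>. \<Sum>\<sigma>\<in>A \<rightarrow>\<^sub>E {-1, 1}. g \<sigma> * indicator (E \<sigma>) \<epsilon>) \<in> borel_measurable rademacher_seq"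
      using E_sets by measurable
    show "AE \<epsilon> in rademacher_seq. g \<epsilon> = (\<Sum>\<sigma>\<in>A \<rightarrow>\<^sub>E {-1, 1}. g \<sigma> * indicator (E \<sigma>) \<epsilon>)"
      using AE1
    proof eventually_elim
      case (elim \<epsilon>)
      define \<sigma> where "\<sigma> = restrict \<epsilon> A"
      have \<sigma>: "\<sigma> \<in> A \<rightarrow>\<^sub>E {-1, 1}" using elim unfolding \<sigma>_def by (intro restrict_PiE_iff[THEN iffD2]) auto
      have "\<epsilon> \<in> E \<tau> \<longleftrightarrow> \<tau> = \<sigma>" if "\<tau> \<in> A \<rightarrow>\<^sub>E {-1, 1}" for \<tau>
      proof
        assume "\<epsilon> \<in> E \<tau>"
        then show "\<tau> = \<sigma>" using that by (intro PiE_ext[OF that \<sigma>]) (auto simp: E_def \<sigma>_def)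
      qed (auto simp: E_def \<sigma>_def)
      then have "(\<Sum>\<tau>\<in>A \<rightarrow>\<^sub>E {-1, 1}. g \<tau> * indicator (E \<tau>) \<epsilon>)
          = (\<Sum>\<tau>\<in>A \<rightarrow>\<^sub>E {-1, 1}. if \<tau> = \<sigma> then g \<tau> else 0)"
        by (intro sum.cong) (auto simp: indicator_def)
      also have "\<dots> = g \<sigma>" using \<sigma> assms(1) by (simp add: finite_PiE)
      also have "\<dots> = g \<epsilon>" by (rule dep) (simp add: \<sigma>_def)
      finally show ?case by simp
    qed
  qed (rule meas)
  also have "\<dots> = (\<Sum>\<sigma>\<in>A \<rightarrow>\<^sub>E {-1, 1}. g \<sigma> * measure rademacher_seq (E \<sigma>))"
  proof -
    have "integrable rademacher_seq (\<lambda>\<epsilon>. g \<sigma> * indicator (E \<sigma>) \<epsilon>)" for \<sigma>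
      using E_sets[of \<sigma>]
      by (intro integrable_mult_right integrable_real_indicator) (auto simp: R P.emeasure_eq_measure)
    then show ?thesis
      using E_sets by (subst Bochner_Integration.integral_sum) (auto simp: Int_absorb1 sets.sets_into_space)
  qed
  also have "\<dots> = sign_mean A g"
    by (simp add: E_measure sign_mean_def sum_divide_distrib cong: sum.cong)
  finally show ?thesis .
qed

lemma rider_norm_eq_sign_mean:
  assumes "trig_poly f"
  shows "finite (fourier_spectrum f)"
    and "rider_norm f = sign_mean (fourier_spectrum f) (rand_sup (fourier_spectrum f) (fourier_coeff f))"
proof -
  obtain A c where A: "finite A" and f: "f = (\<lambda>x. \<Sum>n\<in>A. c n * char_fn n x)"
    using assms unfolding trig_poly_def by blast
  have "fourier_spectrum f \<subseteq> A"
    unfolding fourier_spectrum_def f by (auto simp: fourier_coeff_poly[OF A])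
  with A show fin: "finite (fourier_spectrum f)" by (rule rev_finite_subset)
  have "(LINT \<epsilon>|rademacher_seq. rand_sup (fourier_spectrum f) (fourier_coeff f) \<epsilon>)
      = sign_mean (fourier_spectrum f) (rand_sup (fourier_spectrum f) (fourier_coeff f))"
    by (rule integral_rademacher_seq[OF fin rand_sup_measurable]) (simp add: rand_sup_def)
  then show "rider_norm f = sign_mean (fourier_spectrum f) (rand_sup (fourier_spectrum f) (fourier_coeff f))"
    by (simp add: rider_norm_def rand_sup_def)
qed

section \<open>A criterion for p-Rider sets\<close>

text \<open>The last hypothesis says that the k-th largest value is at most
  \<open>D * k powr (- r)\<close>. It is phrased through subsets so that the induction can remove
  one small element at a time and no ordering has to be chosen.\<close>

lemma sum_powr_le_by_rank:
  fixes x :: "'i \<Rightarrow> real"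
  assumes "finite A" "p \<ge> 0" "\<And>n. n \<in> A \<Longrightarrow> x n \<ge> 0"
    and "\<And>B. B \<subseteq> A \<Longrightarrow> B \<noteq> {} \<Longrightarrow> \<exists>n\<in>B. x n \<le> D * real (card B) powr (- r)"
  shows "(\<Sum>n\<in>A. x n powr p) \<le> (\<Sum>k=1..card A. (D * real k powr (- r)) powr p)"
  using assms
proof (induction "card A" arbitrary: A)
  case (Suc N)
  then have "A \<noteq> {}" by auto
  then obtain n where n: "n \<in> A" "x n \<le> D * real (card A) powr (- r)" using Suc.prems(4)[of A] by auto
  have N: "card (A - {n}) = N" using Suc n by simp
  have "(\<Sum>n\<in>A - {n}. x n powr p) \<le> (\<Sum>k=1..card (A - {n}). (D * real k powr (- r)) powr p)"
    using Suc.prems N by (intro Suc.hyps(1)) auto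
  moreover have "x n powr p \<le> (D * real (card A) powr (- r)) powr p"
    using n Suc.prems by (intro powr_mono2) auto
  moreover have "card A = Suc N" using Suc by simp
  ultimately show ?case
    using n Suc.prems(1) by (simp add: sum.remove N)
qed simp

text \<open>When \<open>T\<close> has at most of order \<open>J\<^sup>2\<close> elements below
  \<open>2 ^ J\<close>, the exponent \<open>2 * e\<close> makes relations above \<open>2 ^ J\<close>
  at least as long, up to a constant, as the e-th power of that count.\<close>

definition sparse_relations :: "nat set \<Rightarrow> real \<Rightarrow> bool" where
  "sparse_relations T e \<longleftrightarrow> (\<exists>c. 0 < c \<and> c \<le> 1 \<and> (\<forall>J S. finite S \<longrightarrow> S \<noteq> {} \<longrightarrow> S \<subseteq> T \<inter> {2 ^ J..} \<longrightarrow>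
      \<not> relation_free (int ` S) \<longrightarrow> c * real (J + 1) powr (2 * e) \<le> real (card S)))"

text \<open>The frequencies below \<open>2 ^ J\<close> are discarded from \<open>B\<close>, with
  \<open>J\<close> such that at least half of \<open>B\<close> remains. Relations among the rest
  have length at least of order \<open>card B powr e\<close>; taking \<open>s\<close> of this order
  in \<open>sum_norm_le_sign_mean\<close> bounds the sum of the moduli, which is at least
  \<open>\<alpha> * card B / 2\<close>.\<close>

lemma coeff_le_card_powr:
  fixes T :: "nat set" and K c e :: real
  assumes "0 \<notin> T" and e: "0 < e" "e < 1" and "K \<ge> 1" and c: "0 < c" "c \<le> 1"
    and count: "\<And>J. real (card (T \<inter> {..<2 ^ J})) \<le> K * (real J)\<^sup>2"
    and relations: "\<And>J S. finite S \<Longrightarrow> S \<noteq> {} \<Longrightarrow> S \<subseteq> T \<inter> {2 ^ J..} \<Longrightarrow>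
      \<not> relation_free (int ` S) \<Longrightarrow> c * real (J + 1) powr (2 * e) \<le> real (card S)"
    and A: "finite A" "A \<subseteq> int ` T" and B: "B \<subseteq> A" "B \<noteq> {}"
    and \<alpha>: "\<alpha> \<ge> 0" "\<And>n. n \<in> B \<Longrightarrow> \<alpha> \<le> norm (a n)"
  shows "\<alpha> \<le> 8 * sqrt (2 * exp 1 * (2 * K) powr e / c) * sign_mean A (rand_sup A a) * real (card B) powr (- ((1 + e) / 2))"
proof -
  define m where "m = real (card B)"
  have finB: "finite B" using A(1) B(1) finite_subset by auto
  then have "card B \<ge> 1" using B by (simp add: Suc_le_eq card_gt_0_iff)
  then have "m \<ge> 1" by (simp add: m_def)
  define R where "R = sign_mean A (rand_sup A a)"
  have "0 \<le> R" using order_trans[OF _ l2_le_sign_mean_rand_sup[OF A(1), of a]]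
    by (simp add: R_def sum_nonneg)
  \<comment> \<open>Chosen so that the at most \<open>K * (real J)\<^sup>2 \<le> K * y\<close>
    elements of \<open>T\<close> below \<open>2 ^ J\<close> make up no more than half of
    \<open>B\<close>.\<close>
  define y where "y = m / (2 * K)"
  have "y > 0" using \<open>m \<ge> 1\<close> \<open>K \<ge> 1\<close> by (simp add: y_def)
  define J where "J = nat \<lfloor>sqrt y\<rfloor>"
  have J: "real J \<le> sqrt y" "sqrt y \<le> real (J + 1)" using \<open>y > 0\<close> unfolding J_def by (auto simp: of_nat_nat) linarith
  have J2: "(real J)\<^sup>2 \<le> y" using J(1) \<open>y > 0\<close> by (metis less_imp_le of_nat_0_le_iff power_mono real_sqrt_pow2)
  define B' where "B' = {n \<in> B. 2 ^ J \<le> n}"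
  have "B - B' \<subseteq> int ` (T \<inter> {..<2 ^ J})"
  proof
    fix n assume n: "n \<in> B - B'"
    then obtain k where k: "k \<in> T" "n = int k" using A B by auto
    then have "int k < int (2 ^ J)" using n by (auto simp: B'_def)
    then have "k < 2 ^ J" by (simp only: of_nat_less_iff)
    with k show "n \<in> int ` (T \<inter> {..<2 ^ J})" by auto
  qed
  then have "card (B - B') \<le> card (int ` (T \<inter> {..<2 ^ J}))" by (intro card_mono) auto
  also have "\<dots> = card (T \<inter> {..<2 ^ J})" by (simp add: card_image)
  finally have "real (card (B - B')) \<le> K * y"
    using count[of J] mult_left_mono[OF J2, of K] \<open>K \<ge> 1\<close> by linarith
  also have "K * y = m / 2" using \<open>K \<ge> 1\<close> by (simp add: y_def)
  finally have half: "m / 2 \<le> real (card B')"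
    using finB card_Diff_subset[of B' B] card_mono[of B B'] by (auto simp: B'_def m_def of_nat_diff)
  have card_B': "real (card B') \<le> m"
    unfolding m_def using finB by (intro of_nat_mono card_mono) (auto simp: B'_def)
  \<comment> \<open>The factor 1/2 ensures \<open>s \<le> card B'\<close>, since
    \<open>c \<le> 1\<close>, \<open>y powr e \<le> m\<close> and
    \<open>card B' \<ge> m / 2\<close>. As \<open>sqrt y \<le> J + 1\<close>, relations in
    \<open>B'\<close> have at least \<open>s\<close> elements.\<close>
  define s where "s = c / 2 * y powr e"
  have "s > 0" using c \<open>y > 0\<close> by (simp add: s_def)
  have "y powr e \<le> m"
  proof -
    have "y \<le> m" using \<open>m \<ge> 1\<close> \<open>K \<ge> 1\<close> by (simp add: y_def divide_le_eq mult_le_cancel_left1)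
    then have "y powr e \<le> m powr e" using \<open>y > 0\<close> e by (intro powr_mono2) auto
    also have "\<dots> \<le> m powr 1" using e \<open>m \<ge> 1\<close> by (intro powr_mono) auto
    finally show ?thesis using \<open>m \<ge> 1\<close> by simp
  qed
  then have "c / 2 * y powr e \<le> 1 / 2 * m" using c by (intro mult_mono) auto
  then have "s \<le> card B'" using half by (simp add: s_def)
  have "y powr e = sqrt y powr (2 * e)"
    using \<open>y > 0\<close> by (simp add: powr_half_sqrt[symmetric] powr_powr)
  also have "\<dots> \<le> real (J + 1) powr (2 * e)" using J \<open>y > 0\<close> e by (intro powr_mono2) auto
  finally have "s \<le> c / 2 * real (J + 1) powr (2 * e)" using c by (simp add: s_def)
  also have "\<dots> \<le> c * real (J + 1) powr (2 * e)" using c by simp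
  finally have sJ: "s \<le> c * real (J + 1) powr (2 * e)" .
  have free: "relation_free S" if S: "S \<subseteq> B'" "S \<noteq> {}" "card S < s" for S
  proof (rule ccontr)
    assume rel: "\<not> relation_free S"
    define S0 where "S0 = nat ` S"
    have mem: "n \<in> int ` T \<and> 2 ^ J \<le> n" if "n \<in> S" for n
      using that S(1) A(2) B(1) by (auto simp: B'_def)
    have eq: "int ` S0 = S" using mem by (force simp: S0_def image_image)
    have "S0 \<subseteq> T \<inter> {2 ^ J..}"
    proof
      fix k assume "k \<in> S0"
      then have "int k \<in> S" using eq by auto
      then have "k \<in> T" "int (2 ^ J) \<le> int k" using mem[of "int k"] by auto
      then show "k \<in> T \<inter> {2 ^ J..}" by (simp only: of_nat_le_iff) auto
    qed
    moreover have "finite S0" using S finB finite_subset[of S B] by (auto simp: S0_def B'_def)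
    ultimately have "c * real (J + 1) powr (2 * e) \<le> real (card S0)"
      using rel S(2) eq by (intro relations) (auto simp: S0_def)
    also have "card S0 = card S" using card_image[of int S0] eq by simp
    finally show False using S(3) sJ by simp
  qed
  have "0 \<notin> B'" using A B \<open>0 \<notin> T\<close> by (auto simp: B'_def)
  have "\<alpha> * (m / 2) \<le> \<alpha> * card B'" using half \<alpha> by (intro mult_left_mono) auto
  also have "\<dots> \<le> (\<Sum>n\<in>B'. norm (a n))"
    using sum_mono[of B' "\<lambda>_. \<alpha>" "\<lambda>n. norm (a n)"] \<alpha> by (auto simp: B'_def mult_ac)
  also have "\<dots> \<le> 4 * sqrt (exp 1 * card B' / s) * R"
    unfolding R_def
    by (rule sum_norm_le_sign_mean[OF A(1) _ \<open>0 \<notin> B'\<close> norm_le_rand_sup rand_sup_flip[OF A(1)]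
          l2_le_sign_mean_rand_sup[OF A(1)] \<open>s > 0\<close> \<open>s \<le> card B'\<close> free]) (use B in \<open>auto simp: B'_def\<close>)
  also have "\<dots> \<le> 4 * sqrt (exp 1 * m / s) * R"
    using card_B' \<open>s > 0\<close> \<open>0 \<le> R\<close> by (intro mult_right_mono mult_left_mono) (auto intro!: divide_right_mono)
  finally have "\<alpha> \<le> 8 * R * (sqrt (exp 1 * m / s) / m)" using \<open>m \<ge> 1\<close> by (simp add: field_simps)
  also have "sqrt (exp 1 * m / s) / m = sqrt (exp 1 * m / s / m\<^sup>2)"
    using \<open>m \<ge> 1\<close> by (simp add: real_sqrt_divide real_sqrt_mult)
  also have "exp 1 * m / s / m\<^sup>2 = (2 * exp 1 * (2 * K) powr e / c) * m powr (- (1 + e))"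
  proof -
    have "m powr (- (1 + e)) = inverse (m * m powr e)"
      unfolding powr_minus powr_add using \<open>m \<ge> 1\<close> by simp
    then show ?thesis
      using \<open>m \<ge> 1\<close> \<open>K \<ge> 1\<close> c unfolding s_def y_def
      by (simp add: powr_divide field_simps power2_eq_square)
  qed
  also have "sqrt \<dots> = sqrt (2 * exp 1 * (2 * K) powr e / c) * m powr (- ((1 + e) / 2))"
    unfolding real_sqrt_mult powr_half_sqrt[symmetric, OF powr_ge_zero] powr_powr[of m]
    by (simp add: minus_divide_left)
  finally show ?thesis by (simp add: R_def m_def mult_ac)
qed

text \<open>The previous lemma, applied with \<alpha> the least modulus on an arbitrary subset,
  bounds the k-th largest coefficient by a multiple of \<open>k powr (- (1 + e) / 2)\<close> times
  the norm. The condition \<open>p * (1 + e) > 2\<close> makes the p-th powers summable.\<close>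

theorem p_Rider_if_sparse_relations:
  fixes T :: "nat set" and p e K :: real
  assumes "0 \<notin> T" "0 < e" "e < 1" and p: "p * (1 + e) > 2" "p > 0"
    and count: "\<And>J. real (card (T \<inter> {..<2 ^ J})) \<le> K * (real J)\<^sup>2"
    and relations: "sparse_relations T e"
  shows "p_Rider p T"
proof -
  obtain c where c: "0 < c" "c \<le> 1"
    and rel: "\<And>J S. finite S \<Longrightarrow> S \<noteq> {} \<Longrightarrow> S \<subseteq> T \<inter> {2 ^ J..} \<Longrightarrow>
      \<not> relation_free (int ` S) \<Longrightarrow> c * real (J + 1) powr (2 * e) \<le> real (card S)"
    using relations unfolding sparse_relations_def by blast
  \<comment> \<open>\<open>coeff_le_card_powr\<close> asks for a constant of at least 1.\<close>
  define K' where "K' = max K 1"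
  have count': "real (card (T \<inter> {..<2 ^ J})) \<le> K' * (real J)\<^sup>2" for J
    using count[of J] mult_right_mono[of K K' "(real J)\<^sup>2"] by (simp add: K'_def)
  define C where "C = 8 * sqrt (2 * exp 1 * (2 * K') powr e / c)"
  have "C \<ge> 0" using c by (simp add: C_def)
  define r where "r = (1 + e) / 2"
  have rp: "r * p > 1" using p by (simp add: r_def field_simps)
  define Z where "Z = (\<Sum>k. real k powr (- (r * p)))"
  have summ: "summable (\<lambda>k. real k powr (- (r * p)))" using rp by (simp add: summable_real_powr_iff)
  have "Z \<ge> 0" unfolding Z_def by (intro suminf_nonneg summ) auto
  show ?thesis unfolding p_Rider_def
  proof (intro exI[of _ "C * Z powr (1 / p)"] allI impI)
    fix f assume f: "trig_poly f \<and> fourier_spectrum f \<subseteq> int ` T"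
    define A where "A = fourier_spectrum f"
    define a where "a = fourier_coeff f"
    define R where "R = rider_norm f"
    have finA: "finite A" and R: "R = sign_mean A (rand_sup A a)"
      using rider_norm_eq_sign_mean[of f] f by (auto simp: A_def a_def R_def)
    have "0 \<le> R" using order_trans[OF _ l2_le_sign_mean_rand_sup[OF finA, of a]]
      by (simp add: R sum_nonneg)
    have "\<exists>n\<in>B. norm (a n) \<le> (C * R) * real (card B) powr (- r)" if B: "B \<subseteq> A" "B \<noteq> {}" for B
    proof -
      have "finite B" using finA B finite_subset by auto
      then obtain n where n: "n \<in> B" "\<And>k. k \<in> B \<Longrightarrow> norm (a n) \<le> norm (a k)"
        using B(2) arg_min_if_finite[of B "\<lambda>n. norm (a n)"] by (meson not_le)
      have "norm (a n) \<le> 8 * sqrt (2 * exp 1 * (2 * K') powr e / c) * sign_mean A (rand_sup A a) * real (card B) powr (- ((1 + e) / 2))"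
        using n finA f by (intro coeff_le_card_powr[where T = T] assms c count' rel B) (auto simp: A_def K'_def)
      with n(1) show ?thesis by (auto simp: C_def R r_def mult_ac)
    qed
    then have "(\<Sum>n\<in>A. norm (a n) powr p) \<le> (\<Sum>k=1..card A. ((C * R) * real k powr (- r)) powr p)"
      using finA p by (intro sum_powr_le_by_rank) auto
    also have "\<dots> = (C * R) powr p * (\<Sum>k=1..card A. real k powr (- (r * p)))"
      using \<open>C \<ge> 0\<close> \<open>0 \<le> R\<close> by (simp add: powr_mult powr_powr sum_distrib_left)
    also have "\<dots> \<le> (C * R) powr p * Z"
      unfolding Z_def by (intro mult_left_mono sum_le_suminf summ) auto
    finally have "(\<Sum>n\<in>A. norm (a n) powr p) powr (1 / p) \<le> ((C * R) powr p * Z) powr (1 / p)"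
      using p by (intro powr_mono2) (auto intro: sum_nonneg)
    also have "\<dots> = C * Z powr (1 / p) * R"
      using \<open>C \<ge> 0\<close> \<open>0 \<le> R\<close> \<open>Z \<ge> 0\<close> p by (simp add: powr_mult powr_powr)
    finally show "(\<Sum>n\<in>fourier_spectrum f. norm (fourier_coeff f n) powr p) powr (1 / p)
        \<le> C * Z powr (1 / p) * rider_norm f"
      by (simp add: A_def a_def R_def)
  qed
qed

section \<open>Dense sets are not p-Rider\<close>

text \<open>The convexity estimate behind Hoeffding's lemma, at probability 1/2 and argument
  \<open>2 * y\<close>; evenness covers negative \<open>y\<close>.\<close>

lemma cosh_le_exp_square:
  fixes y :: real
  shows "(exp y + exp (- y)) / 2 \<le> exp (y\<^sup>2 / 2)"
proof -
  have *: "(exp y + exp (- y)) / 2 \<le> exp (y\<^sup>2 / 2)" if "y \<ge> 0" for y :: real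
  proof -
    have "-(2 * y) * (1/2) + ln (1 + 1/2 * (exp (2 * y) - 1)) \<le> (2 * y)\<^sup>2 / 8"
      using that by (intro Hoeffdings_lemma_aux) auto
    then have "ln (1 + 1/2 * (exp (2 * y) - 1)) \<le> y\<^sup>2 / 2 + y" by (simp add: power2_eq_square)
    moreover have "1 + 1/2 * (exp (2 * y) - 1) > 0" using that by (simp add: add_pos_nonneg)
    ultimately have "1 + 1/2 * (exp (2 * y) - 1) \<le> exp (y\<^sup>2 / 2 + y)"
      by (metis exp_le_cancel_iff exp_ln)
    then have "exp (- y) * (1 + 1/2 * (exp (2 * y) - 1)) \<le> exp (- y) * exp (y\<^sup>2 / 2 + y)"
      by (intro mult_left_mono) auto
    then show ?thesis by (simp add: algebra_simps mult_exp_exp add_divide_distrib)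
  qed
  show ?thesis
    using *[of y] *[of "- y"] by (cases "y \<ge> 0") (auto simp: add.commute)
qed

text \<open>Independence factors the exponential moment into hyperbolic cosines, giving the
  subgaussian bound.\<close>

lemma sign_mean_exp_le:
  assumes "finite A" "\<And>n. n \<in> A \<Longrightarrow> \<bar>b n\<bar> \<le> 1"
  shows "sign_mean A (\<lambda>\<epsilon>. exp (\<kappa> * (\<Sum>n\<in>A. \<epsilon> n * b n))) \<le> exp (\<kappa>\<^sup>2 * real (card A) / 2)"
proof -
  have "sign_mean A (\<lambda>\<epsilon>. exp (\<kappa> * (\<Sum>n\<in>A. \<epsilon> n * b n)))
      = sign_mean A (\<lambda>\<epsilon>. \<Prod>n\<in>A. exp (\<epsilon> n * (\<kappa> * b n)))"
    using assms(1) by (simp add: sum_distrib_left exp_sum mult_ac)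
  also have "\<dots> = (\<Prod>n\<in>A. (exp (\<kappa> * b n) + exp (- (\<kappa> * b n))) / 2)"
    by (subst sign_mean_prod[OF assms(1)]) simp
  also have "\<dots> \<le> (\<Prod>n\<in>A. exp (\<kappa>\<^sup>2 / 2))"
  proof (rule prod_mono, intro conjI)
    fix n assume n: "n \<in> A"
    have "(\<kappa> * b n)\<^sup>2 \<le> \<kappa>\<^sup>2 * 1"
      unfolding power_mult_distrib using assms(2)[OF n] by (intro mult_left_mono) (auto simp: abs_square_le_1)
    then show "(exp (\<kappa> * b n) + exp (- (\<kappa> * b n))) / 2 \<le> exp (\<kappa>\<^sup>2 / 2)"
      by (intro order_trans[OF cosh_le_exp_square]) simp
  qed (simp add: add_nonneg_nonneg)
  also have "\<dots> = exp (\<kappa>\<^sup>2 * real (card A) / 2)"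
    by (simp add: exp_of_nat_mult[symmetric] mult_ac)
  finally show ?thesis .
qed

lemma norm_char_fn_diff: "norm (char_fn n x - char_fn n y) \<le> 2 * pi * \<bar>of_int n\<bar> * \<bar>x - y\<bar>"
proof -
  have "char_fn n x - char_fn n y = char_fn n y * (exp (\<i> * of_real (2 * pi * of_int n * (x - y))) - 1)"
    by (simp add: char_fn_def exp_add[symmetric] algebra_simps)
  also have "norm \<dots> = norm (exp (\<i> * of_real (2 * pi * of_int n * (x - y))) - 1)"
    by (simp add: norm_mult)
  also have "\<dots> \<le> \<bar>2 * pi * of_int n * (x - y)\<bar>"
    using dist_exp_i_1[of "2 * pi * of_int n * (x - y)"] abs_sin_x_le_abs_x[of "2 * pi * of_int n * (x - y) / 2"]
    by (simp add: abs_mult)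
  also have "\<dots> = 2 * pi * \<bar>of_int n\<bar> * \<bar>x - y\<bar>" by (simp add: abs_mult)
  finally show ?thesis .
qed

lemma char_fn_frac: "char_fn n (frac x) = char_fn n x"
proof -
  have "char_fn n x = char_fn n (frac x) * cis (2 * pi * of_int (n * \<lfloor>x\<rfloor>))"
    unfolding char_fn_cis cis_mult by (simp add: frac_def algebra_simps)
  then show ?thesis by (simp add: cis_multiple_2pi)
qed

lemma sign_mean_rand_sup_nonneg: "0 \<le> sign_mean A (rand_sup A a)"
  by (simp add: sign_mean_def sum_nonneg rand_sup_nonneg)

text \<open>A union bound over \<open>8 ^ J\<close> grid points, in the form of exponential moments:
  real and imaginary parts with both signs give \<open>4 * 8 ^ J\<close> moments, each at most exp
  (J / 2), and the factor exp (- 4 J) outweighs their number.\<close>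

lemma sign_mean_rand_sup_le:
  assumes A: "finite A" "A \<noteq> {}" "A \<subseteq> {0..<2 ^ J}" and "J \<ge> 1"
  shows "sign_mean A (rand_sup A (\<lambda>_. 1)) \<le> 19 * sqrt (real (card A) * real J)"
proof -
  define m where "m = real (card A)"
  have "card A \<ge> 1" using A by (simp add: Suc_le_eq card_gt_0_iff)
  then have "m \<ge> 1" by (simp add: m_def)
  have "card A \<le> card {0..<2 ^ J :: int}" using A by (intro card_mono) auto
  then have m_le: "m \<le> 2 ^ J" by (simp add: m_def nat_power_eq flip: of_nat_le_iff)
  \<comment> \<open>With \<open>\<kappa>\<^sup>2 * m = J\<close> the moments are at most exp (J /
    2); with \<open>\<kappa> * t = 4 * J\<close> the level \<open>t\<close> beats both these and the
    number of grid points, since \<open>8 \<le> exp 3\<close>.\<close>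
  define \<kappa> where "\<kappa> = sqrt (real J / m)"
  define t where "t = 4 * sqrt (m * real J)"
  have "\<kappa> > 0" using \<open>J \<ge> 1\<close> \<open>m \<ge> 1\<close> by (simp add: \<kappa>_def)
  have \<kappa>2: "\<kappa>\<^sup>2 * m = real J" using \<open>m \<ge> 1\<close> by (simp add: \<kappa>_def)
  have \<kappa>t: "\<kappa> * t = 4 * real J" using \<open>m \<ge> 1\<close>
    by (simp add: \<kappa>_def t_def real_sqrt_mult[symmetric])
  have inv\<kappa>: "1 / \<kappa> \<le> sqrt (m * real J)"
  proof -
    have "1 / \<kappa> = sqrt (m / real J)" by (simp add: \<kappa>_def real_sqrt_divide)
    also have "m / real J \<le> m * real J"
      using \<open>J \<ge> 1\<close> \<open>m \<ge> 1\<close> by (simp add: divide_le_eq mult_le_cancel_left1 mult_ge1_I mult.assoc)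
    finally show ?thesis by simp
  qed
  \<comment> \<open>Moving to a grid point changes each term by at most
    \<open>7 * 2 ^ J / 8 ^ J\<close>. As there are \<open>m \<le> 2 ^ J\<close> terms, the
    polynomial changes by at most 7.\<close>
  define Q :: nat where "Q = 8 ^ J"
  have "Q > 0" by (simp add: Q_def)
  define x where "x = (\<lambda>k. real k / real Q)"
  define X where "X = (\<lambda>k \<epsilon>. \<Sum>n\<in>A. \<epsilon> n * cos (2 * pi * of_int n * x k))"
  define Y where "Y = (\<lambda>k \<epsilon>. \<Sum>n\<in>A. \<epsilon> n * sin (2 * pi * of_int n * x k))"
  define G where "G = (\<lambda>k \<epsilon>. exp (\<kappa> * X k \<epsilon>) + exp (- \<kappa> * X k \<epsilon>) + exp (\<kappa> * Y k \<epsilon>) + exp (- \<kappa> * Y k \<epsilon>))"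
  \<comment> \<open>Majorant of the sup norm: 7 for the discretisation, \<open>t\<close> for the
    real and the imaginary part each, and a sum of exponentials for the excess over
    \<open>t\<close>.\<close>
  define H where "H = (\<lambda>\<epsilon>. 7 + 2 * t + (exp (- (\<kappa> * t)) / \<kappa>) * (\<Sum>k<Q. G k \<epsilon>))"
  have abs_le: "\<bar>z\<bar> \<le> t + (exp (- (\<kappa> * t)) / \<kappa>) * (exp (\<kappa> * z) + exp (- \<kappa> * z))" for z
  proof -
    have "\<kappa> * (\<bar>z\<bar> - t) \<le> exp (\<kappa> * (\<bar>z\<bar> - t))"
      using exp_ge_add_one_self[of "\<kappa> * (\<bar>z\<bar> - t)"] by linarith
    also have "\<dots> = exp (- (\<kappa> * t)) * exp (\<kappa> * \<bar>z\<bar>)" by (simp add: mult_exp_exp algebra_simps)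
    also have "\<dots> \<le> exp (- (\<kappa> * t)) * (exp (\<kappa> * z) + exp (- \<kappa> * z))"
      by (intro mult_left_mono) (auto simp: abs_if)
    finally show ?thesis using \<open>\<kappa> > 0\<close> by (simp add: field_simps)
  qed
  have "rand_sup A (\<lambda>_. 1) \<epsilon> \<le> H \<epsilon>" if \<epsilon>: "\<epsilon> \<in> A \<rightarrow>\<^sub>E {-1, 1}" for \<epsilon>
    unfolding rand_sup_def
  proof (rule sup_norm_least)
    fix y
    \<comment> \<open>By periodicity \<open>y\<close> may be replaced by its fractional part;
      \<open>x k\<close> is the grid point to the left of it.\<close>
    define k where "k = nat \<lfloor>real Q * frac y\<rfloor>"
    have k0: "real k = of_int \<lfloor>real Q * frac y\<rfloor>" by (simp add: k_def frac_ge_0)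
    have "real Q * frac y < real Q * 1" using \<open>Q > 0\<close> frac_lt_1[of y] by (intro mult_strict_left_mono) auto
    then have "real k < real Q" unfolding k0 by linarith
    then have "k < Q" by simp
    have "\<bar>real Q * frac y - real k\<bar> \<le> 1" unfolding k0 by linarith
    moreover have "frac y - x k = (real Q * frac y - real k) / real Q"
      using \<open>Q > 0\<close> by (simp add: x_def field_simps)
    ultimately have "\<bar>frac y - x k\<bar> \<le> 1 / real Q"
      by (simp add: divide_right_mono)
    then have dist: "\<bar>frac y - x k\<bar> \<le> 1 / 8 ^ J" by (simp add: Q_def)
    have "norm (of_real (\<epsilon> n) * 1 * char_fn n (frac y) - of_real (\<epsilon> n) * 1 * char_fn n (x k)) \<le> 7 * 2 ^ J * (1 / 8 ^ J)"
      if n: "n \<in> A" for n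
    proof -
      have "norm (of_real (\<epsilon> n) :: complex) = 1" using PiE_mem[OF \<epsilon> n] by auto
      then have "norm (of_real (\<epsilon> n) * 1 * char_fn n (frac y) - of_real (\<epsilon> n) * 1 * char_fn n (x k))
          = norm (char_fn n (frac y) - char_fn n (x k))"
        by (simp add: norm_mult flip: right_diff_distrib)
      also have "\<dots> \<le> 2 * pi * \<bar>of_int n\<bar> * \<bar>frac y - x k\<bar>" by (rule norm_char_fn_diff)
      also have "\<dots> \<le> 7 * 2 ^ J * (1 / 8 ^ J)"
      proof (intro mult_mono dist)
        have "n \<ge> 0" "n \<le> 2 ^ J" using n A(3) by auto
        then have "real_of_int n \<le> real_of_int (2 ^ J)" by (simp only: of_int_le_iff)
        then show "\<bar>real_of_int n\<bar> \<le> 2 ^ J" using \<open>n \<ge> 0\<close> by simp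
        show "2 * pi \<le> 7" using pi_approx by simp
      qed auto
      finally show ?thesis .
    qed
    then have "norm (\<Sum>n\<in>A. of_real (\<epsilon> n) * 1 * char_fn n (frac y) - of_real (\<epsilon> n) * 1 * char_fn n (x k))
        \<le> (\<Sum>n\<in>A. 7 * 2 ^ J * (1 / 8 ^ J))"
      by (intro order_trans[OF norm_sum] sum_mono) auto
    also have "\<dots> \<le> 7"
    proof -
      have "(8::real) ^ J = 2 ^ J * (2 ^ J * 2 ^ J)" by (simp flip: power_mult_distrib)
      then have "(\<Sum>n\<in>A. 7 * 2 ^ J * (1 / 8 ^ J)) = 7 * (m / 2 ^ J) / 2 ^ J" by (simp add: m_def)
      also have "\<dots> \<le> 7 * 1 / 1" using m_le by (intro frac_le mult_left_mono) auto
      finally show ?thesis by simp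
    qed
    finally have near: "norm (\<Sum>n\<in>A. of_real (\<epsilon> n) * 1 * char_fn n (frac y) - of_real (\<epsilon> n) * 1 * char_fn n (x k)) \<le> 7"
      by simp
    have "(\<Sum>n\<in>A. of_real (\<epsilon> n) * 1 * char_fn n (x k)) = Complex (X k \<epsilon>) (Y k \<epsilon>)"
      by (simp add: complex_eq_iff X_def Y_def char_fn_cis)
    then have "norm (\<Sum>n\<in>A. of_real (\<epsilon> n) * 1 * char_fn n (x k)) \<le> \<bar>X k \<epsilon>\<bar> + \<bar>Y k \<epsilon>\<bar>"
      by (metis cmod_le complex.sel)
    moreover have "(\<Sum>n\<in>A. of_real (\<epsilon> n) * 1 * char_fn n y)
       = (\<Sum>n\<in>A. of_real (\<epsilon> n) * 1 * char_fn n (frac y) - of_real (\<epsilon> n) * 1 * char_fn n (x k))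
         + (\<Sum>n\<in>A. of_real (\<epsilon> n) * 1 * char_fn n (x k))"
      by (simp add: sum_subtractf char_fn_frac)
    ultimately have "norm (\<Sum>n\<in>A. of_real (\<epsilon> n) * 1 * char_fn n y) \<le> 7 + (\<bar>X k \<epsilon>\<bar> + \<bar>Y k \<epsilon>\<bar>)"
      using near norm_triangle_le by (smt (verit))
    also have "\<dots> \<le> 7 + 2 * t + (exp (- (\<kappa> * t)) / \<kappa>) * G k \<epsilon>"
      using abs_le[of "X k \<epsilon>"] abs_le[of "Y k \<epsilon>"] by (simp add: G_def algebra_simps)
    also have "\<dots> \<le> H \<epsilon>"
    proof -
      have "G k \<epsilon> \<le> (\<Sum>k<Q. G k \<epsilon>)"
        using \<open>k < Q\<close> by (intro member_le_sum) (auto simp: G_def intro!: add_nonneg_nonneg)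
      then show ?thesis using \<open>\<kappa> > 0\<close> unfolding H_def by (intro add_left_mono mult_left_mono) auto
    qed
    finally show "norm (\<Sum>n\<in>A. of_real (\<epsilon> n) * 1 * char_fn n y) \<le> H \<epsilon>" .
  qed
  then have "sign_mean A (rand_sup A (\<lambda>_. 1)) \<le> sign_mean A H" by (rule sign_mean_mono)
  also have "\<dots> = 7 + 2 * t + (exp (- (\<kappa> * t)) / \<kappa>) * (\<Sum>k<Q. sign_mean A (G k))"
    unfolding H_def using A by (simp only: sign_mean_add sign_mean_cmult sign_mean_const sign_mean_sum)
  also have "\<dots> \<le> 7 + 2 * t + (exp (- (\<kappa> * t)) / \<kappa>) * (\<Sum>k<Q. 4 * exp (real J / 2))"
  proof (intro add_left_mono mult_left_mono sum_mono)
    fix k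
    have mgf: "sign_mean A (\<lambda>\<epsilon>. exp (\<mu> * (\<Sum>n\<in>A. \<epsilon> n * b n))) \<le> exp (real J / 2)"
      if "\<mu>\<^sup>2 = \<kappa>\<^sup>2" "\<And>n. \<bar>b n\<bar> \<le> 1" for \<mu> b
      using sign_mean_exp_le[of A b \<mu>] that A \<kappa>2 by (simp add: m_def)
    have "sign_mean A (G k) \<le> exp (real J / 2) + exp (real J / 2) + exp (real J / 2) + exp (real J / 2)"
      unfolding G_def sign_mean_add X_def Y_def by (intro add_mono mgf) auto
    then show "sign_mean A (G k) \<le> 4 * exp (real J / 2)" by simp
  qed (use \<open>\<kappa> > 0\<close> in auto)
  also have "\<dots> = 7 + 2 * t + 4 * (8 ^ J * exp (real J / 2) * exp (- (4 * real J))) * (1 / \<kappa>)"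
    by (simp add: \<kappa>t Q_def)
  also have "\<dots> \<le> 7 + 2 * t + 4 * 1 * (1 / \<kappa>)"
  proof (intro add_left_mono mult_right_mono mult_left_mono)
    have "(8::real) = 2 ^ 3" by simp
    also have "\<dots> \<le> exp 1 ^ 3" using exp_ge_add_one_self[of "1::real"] by (intro power_mono) auto
    finally have "(8::real) ^ J \<le> (exp 1 ^ 3) ^ J" by (intro power_mono) auto
    also have "\<dots> = exp (3 * real J)" by (simp add: exp_of_nat_mult[symmetric] mult.commute flip: power_mult)
    finally have "8 ^ J * exp (real J / 2) * exp (- (4 * real J)) \<le> exp (3 * real J) * exp (real J / 2) * exp (- (4 * real J))"
      by (intro mult_right_mono) auto
    also have "\<dots> \<le> 1" by (simp add: mult_exp_exp)
    finally show "8 ^ J * exp (real J / 2) * exp (- (4 * real J)) \<le> 1" .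
  qed (use \<open>\<kappa> > 0\<close> in auto)
  \<comment> \<open>19 = 7 + 2 * 4 + 4, because both 1 and \<open>1 / \<kappa>\<close> are at most
    \<open>sqrt (m * real J)\<close>.\<close>
  also have "\<dots> \<le> 19 * sqrt (m * real J)"
  proof -
    have "1 * 1 \<le> m * real J" using \<open>m \<ge> 1\<close> \<open>J \<ge> 1\<close> by (intro mult_mono) auto
    then have "1 \<le> sqrt (m * real J)" by simp
    then show ?thesis using inv\<kappa> unfolding t_def by linarith
  qed
  finally show ?thesis by (simp add: m_def)
qed

text \<open>The test polynomials have coefficient 1 at the \<open>m\<close> elements of
  \<open>T\<close> below \<open>2 ^ J\<close>. The Rider inequality would give
  \<open>m powr (1 / p) \<le> 19 * \<bar>C\<bar> * sqrt (m * J)\<close>, while \<open>m\<close> is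
  at least \<open>c * J\<^sup>2\<close>.\<close>

theorem not_p_Rider_if_dense:
  fixes T :: "nat set" and p c :: real
  assumes p: "1 \<le> p" "p < 4 / 3" and "c > 0"
    and dense: "eventually (\<lambda>J. c * (real J)\<^sup>2 \<le> real (card (T \<inter> {..<2 ^ J}))) sequentially"
  shows "\<not> p_Rider p T"
proof
  assume "p_Rider p T"
  then obtain C where C: "\<And>f. trig_poly f \<Longrightarrow> fourier_spectrum f \<subseteq> int ` T \<Longrightarrow>
      (\<Sum>n\<in>fourier_spectrum f. norm (fourier_coeff f n) powr p) powr (1 / p) \<le> C * rider_norm f"
    unfolding p_Rider_def by blast
  \<comment> \<open>Inserting \<open>m \<ge> c * J\<^sup>2\<close> leaves J to the power
    \<open>2 * r - 1 / 2\<close>, that is 2/p - 3/2, bounded; this exponent is positive exactly for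
    \<open>p < 4 / 3\<close>.\<close>
  define r where "r = 1 / p - 1 / 2"
  have r: "2 * r - 1 / 2 > 0" using p by (simp add: r_def field_simps)
  have bound: "c powr r * real J powr (2 * r - 1 / 2) \<le> 19 * \<bar>C\<bar>"
    if J: "J \<ge> 1" "c * (real J)\<^sup>2 \<le> real (card (T \<inter> {..<2 ^ J}))" for J
  proof -
    define A where "A = int ` (T \<inter> {..<2 ^ J})"
    define m where "m = real (card A)"
    have cm: "c * (real J)\<^sup>2 \<le> m" using J by (simp add: m_def A_def card_image)
    moreover have "0 < c * (real J)\<^sup>2" using \<open>c > 0\<close> J(1) by simp
    ultimately have "m > 0" by linarith
    then have "A \<noteq> {}" by (auto simp: m_def)
    have "finite A" by (simp add: A_def)
    have "A \<subseteq> {0..<2 ^ J}"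
    proof
      fix n assume "n \<in> A"
      then obtain k where "n = int k" "k < 2 ^ J" by (auto simp: A_def)
      then have "int k < int (2 ^ J)" by (simp only: of_nat_less_iff)
      then show "n \<in> {0..<2 ^ J}" using \<open>n = int k\<close> by simp
    qed
    define f where "f = (\<lambda>x. \<Sum>n\<in>A. 1 * char_fn n x)"
    have f: "trig_poly f" unfolding trig_poly_def f_def
      by (intro exI[of _ A] exI[of _ "\<lambda>_. 1"] conjI \<open>finite A\<close> refl)
    have coeff: "fourier_coeff f n = (if n \<in> A then 1 else 0)" for n
      unfolding f_def by (rule fourier_coeff_poly[OF \<open>finite A\<close>])
    have spec: "fourier_spectrum f = A" by (auto simp: fourier_spectrum_def coeff)
    have "m powr (1 / p) \<le> C * rider_norm f"
      using C[OF f] by (simp add: spec coeff m_def) (auto simp: A_def)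
    also have "rider_norm f = sign_mean A (rand_sup A (\<lambda>_. 1))"
      unfolding rider_norm_eq_sign_mean(2)[OF f] spec rand_sup_def
      by (intro sign_mean_cong arg_cong[of _ _ sup_norm] ext sum.cong) (auto simp: coeff)
    also have "C * \<dots> \<le> \<bar>C\<bar> * (19 * sqrt (m * real J))"
      using sign_mean_rand_sup_le[OF \<open>finite A\<close> \<open>A \<noteq> {}\<close> \<open>A \<subseteq> {0..<2 ^ J}\<close> J(1)]
        sign_mean_rand_sup_nonneg
      by (intro mult_mono) (auto simp: m_def)
    also have "\<dots> = 19 * \<bar>C\<bar> * (m powr (1 / 2) * real J powr (1 / 2))"
      using \<open>m > 0\<close> by (simp add: real_sqrt_mult powr_half_sqrt)
    finally have le: "m powr (1 / p) \<le> 19 * \<bar>C\<bar> * (m powr (1 / 2) * real J powr (1 / 2))" .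
    have "m powr r = m powr (1 / p) * m powr (- (1 / 2))" unfolding powr_add[symmetric] r_def by simp
    also have "\<dots> \<le> 19 * \<bar>C\<bar> * (m powr (1 / 2) * real J powr (1 / 2)) * m powr (- (1 / 2))"
      by (intro mult_right_mono le) auto
    also have "\<dots> = 19 * \<bar>C\<bar> * real J powr (1 / 2) * (m powr (1 / 2) * m powr (- (1 / 2)))" by simp
    also have "m powr (1 / 2) * m powr (- (1 / 2)) = 1" unfolding powr_add[symmetric] using \<open>m > 0\<close> by simp
    finally have mr: "m powr r \<le> 19 * \<bar>C\<bar> * real J powr (1 / 2)" by simp
    have "c powr r * real J powr (2 * r) = (c * (real J)\<^sup>2) powr r"
      using \<open>c > 0\<close> J(1) by (simp add: powr_mult powr_powr flip: powr_numeral)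
    also have "\<dots> \<le> m powr r" using cm \<open>c > 0\<close> r by (intro powr_mono2) auto
    finally have "c powr r * real J powr (2 * r) \<le> 19 * \<bar>C\<bar> * real J powr (1 / 2)" using mr by simp
    moreover have "real J powr (1 / 2) > 0" using J(1) by simp
    ultimately show ?thesis
      unfolding powr_diff times_divide_eq_right by (simp only: pos_divide_le_eq)
  qed
  have "filterlim (\<lambda>J. exp ((2 * r - 1 / 2) * ln (real J))) at_top sequentially"
    using r by (intro filterlim_compose[OF exp_at_top] filterlim_compose[OF ln_at_top]
        filterlim_tendsto_pos_mult_at_top[OF tendsto_const] filterlim_real_sequentially) auto
  then have "filterlim (\<lambda>J. real J powr (2 * r - 1 / 2)) at_top sequentially"
    by (rule filterlim_cong[OF refl refl, THEN iffD1, rotated])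
      (use eventually_gt_at_top[of 0] in eventually_elim, simp add: powr_def)
  then have "filterlim (\<lambda>J. c powr r * real J powr (2 * r - 1 / 2)) at_top sequentially"
    using \<open>c > 0\<close> by (intro filterlim_tendsto_pos_mult_at_top[OF tendsto_const]) auto
  then have "eventually (\<lambda>J. 19 * \<bar>C\<bar> < c powr r * real J powr (2 * r - 1 / 2)) sequentially"
    by (simp add: filterlim_at_top_dense)
  then have "eventually (\<lambda>J::nat. False) sequentially"
    using dense eventually_ge_at_top[of 1] by eventually_elim (use bound in fastforce)
  then show False by simp
qed

section \<open>The random set\<close>

text \<open>The sum is the expected number of elements of the random set below \<open>2 ^ J\<close>.
  The dyadic block from \<open>2 ^ J\<close> to \<open>2 ^ Suc J\<close> contributes between J / 4
  and J + 1, and the blocks are added up by induction.\<close>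

lemma sum_ln_over_self_bounds:
  shows "(\<Sum>k\<in>{1..<2 ^ J}. ln (real k) / real k) \<le> (real J)\<^sup>2"
    and "real J * (real J - 1) / 8 \<le> (\<Sum>k\<in>{1..<2 ^ J}. ln (real k) / real k)"
proof -
  have "(\<Sum>k\<in>{1..<2 ^ J}. ln (real k) / real k) \<le> (real J)\<^sup>2 \<and>
    real J * (real J - 1) / 8 \<le> (\<Sum>k\<in>{1..<2 ^ J}. ln (real k) / real k)"
  proof (induction J)
    case (Suc J)
    have card: "card {2 ^ J..<2 ^ Suc J :: nat} = 2 ^ J" by simp
    have split: "(\<Sum>k\<in>{1..<2 ^ Suc J}. ln (real k) / real k)
        = (\<Sum>k\<in>{1..<2 ^ J}. ln (real k) / real k) + (\<Sum>k\<in>{2 ^ J..<2 ^ Suc J}. ln (real k) / real k)"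
      by (rule sum.atLeastLessThan_concat[symmetric]) auto
    have bounds: "real J / 4 / 2 ^ J \<le> ln (real k) / real k \<and> ln (real k) / real k \<le> (real J + 1) / 2 ^ J"
      if k: "k \<in> {2 ^ J..<2 ^ Suc J}" for k
    proof -
      have "2 ^ J \<le> k" "k \<le> 2 ^ Suc J" using k by auto
      then have "real (2 ^ J) \<le> real k" "real k \<le> real (2 ^ Suc J)" by (simp_all only: of_nat_le_iff)
      then have k1: "2 ^ J \<le> real k" and k2: "real k \<le> 2 ^ Suc J" by simp_all
      have "0 < real k" by (rule less_le_trans[OF _ k1]) simp
      have "ln (real k) \<le> ln (2 ^ Suc J)" using k2 \<open>0 < real k\<close> by simp
      also have "\<dots> = (real J + 1) * ln 2" by (subst ln_realpow) auto
      also have "\<dots> \<le> (real J + 1) * 1" using ln_2_less_1 by (intro mult_left_mono) auto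
      finally have up: "ln (real k) \<le> real J + 1" by simp
      have "real J * (1 / 2) \<le> real J * ln 2" using ln2_ge_two_thirds by (intro mult_left_mono) auto
      also have "\<dots> = ln (2 ^ J)" by (subst ln_realpow) auto
      also have "\<dots> \<le> ln (real k)" using k1 \<open>0 < real k\<close> by simp
      finally have lo: "real J / 2 \<le> ln (real k)" by simp
      have "real J / 4 / 2 ^ J = (real J / 2) / 2 ^ Suc J" by simp
      also have "\<dots> \<le> ln (real k) / real k" using lo k2 \<open>0 < real k\<close> by (intro frac_le) auto
      finally show ?thesis using up k1 by (auto intro!: frac_le)
    qed
    have "(\<Sum>k\<in>{2 ^ J..<2 ^ Suc J}. ln (real k) / real k) \<le> (\<Sum>k\<in>{2 ^ J..<2 ^ Suc J :: nat}. (real J + 1) / 2 ^ J)"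
      by (intro sum_mono) (use bounds in blast)
    also have "\<dots> = real J + 1" unfolding sum_constant card by simp
    finally have up: "(\<Sum>k\<in>{2 ^ J..<2 ^ Suc J}. ln (real k) / real k) \<le> real J + 1" .
    have "real J / 4 = (\<Sum>k\<in>{2 ^ J..<2 ^ Suc J :: nat}. real J / 4 / 2 ^ J)" unfolding sum_constant card by simp
    also have "\<dots> \<le> (\<Sum>k\<in>{2 ^ J..<2 ^ Suc J}. ln (real k) / real k)"
      by (intro sum_mono) (use bounds in blast)
    finally have lo: "real J / 4 \<le> (\<Sum>k\<in>{2 ^ J..<2 ^ Suc J}. ln (real k) / real k)" .
    show ?case unfolding split
    proof
      have "(real J)\<^sup>2 + (real J + 1) \<le> (real (Suc J))\<^sup>2" by (simp add: power2_eq_square algebra_simps)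
      then show "(\<Sum>k\<in>{1..<2 ^ J}. ln (real k) / real k) + (\<Sum>k\<in>{2 ^ J..<2 ^ Suc J}. ln (real k) / real k)
          \<le> (real (Suc J))\<^sup>2" using up Suc by linarith
      have "real (Suc J) * (real (Suc J) - 1) / 8 = real J * (real J - 1) / 8 + real J / 4"
        by (simp add: field_simps)
      then show "real (Suc J) * (real (Suc J) - 1) / 8
         \<le> (\<Sum>k\<in>{1..<2 ^ J}. ln (real k) / real k) + (\<Sum>k\<in>{2 ^ J..<2 ^ Suc J}. ln (real k) / real k)"
        using lo Suc by linarith
    qed
  qed simp
  then show "(\<Sum>k\<in>{1..<2 ^ J}. ln (real k) / real k) \<le> (real J)\<^sup>2"
    and "real J * (real J - 1) / 8 \<le> (\<Sum>k\<in>{1..<2 ^ J}. ln (real k) / real k)" by auto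
qed

text \<open>Taking logarithms, a relation whose largest element lies in the j-th dyadic block has at
  least of order j / log j elements. The exponentiated form is the one that the union bound
  delivers.\<close>

definition long_relations :: "nat set \<Rightarrow> nat \<Rightarrow> bool" where
  "long_relations T j \<longleftrightarrow> (\<forall>S n. finite S \<longrightarrow> S \<subseteq> T \<longrightarrow> n \<in> S \<longrightarrow> (\<forall>k\<in>S. k \<le> n) \<longrightarrow> 2 ^ j \<le> n \<longrightarrow> n < 2 ^ Suc j \<longrightarrow>
     \<not> relation_free (int ` S) \<longrightarrow> sqrt 2 ^ j < (2 * (real j + 1)\<^sup>2) ^ card S)"

lemma long_relationsD:
  assumes "long_relations T j" "finite S" "S \<subseteq> T" "n \<in> S" "\<forall>k\<in>S. k \<le> n" "2 ^ j \<le> n" "n < 2 ^ Suc j"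
    "\<not> relation_free (int ` S)"
  shows "sqrt 2 ^ j < (2 * (real j + 1)\<^sup>2) ^ card S"
  using assms(1)[unfolded long_relations_def, rule_format] assms(2-) by simp

section \<open>The random set and the exponential moments of its counting function\<close>

locale log_random_set = prob_space M for M :: "'a measure" +
  fixes \<xi> :: "nat \<Rightarrow> 'a \<Rightarrow> nat"
  assumes indep: "indep_vars (\<lambda>_. count_space UNIV) \<xi> {1..}"
    and values_01: "\<And>k \<omega>. k \<ge> 1 \<Longrightarrow> \<omega> \<in> space M \<Longrightarrow> \<xi> k \<omega> \<in> {0, 1}"
    and prob_eq_1: "\<And>k. k \<ge> 1 \<Longrightarrow> prob {\<omega> \<in> space M. \<xi> k \<omega> = 1} = ln (real k) / real k"
begin

definition T :: "'a \<Rightarrow> nat set" where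
  "T \<omega> = {k. k \<ge> 1 \<and> \<xi> k \<omega> = 1}"

lemma measurable_xi: "k \<ge> 1 \<Longrightarrow> \<xi> k \<in> measurable M (count_space UNIV)"
  using indep by (auto simp: indep_vars_def)

lemma sets_eq_1: "k \<ge> 1 \<Longrightarrow> {\<omega> \<in> space M. \<xi> k \<omega> = 1} \<in> events"
  using measurable_sets[OF measurable_xi, of k "{1}"] by (simp add: vimage_def Int_def conj_commute)

lemma sets_subset_T: "finite S \<Longrightarrow> S \<subseteq> {1..} \<Longrightarrow> {\<omega> \<in> space M. S \<subseteq> T \<omega>} \<in> events"
proof -
  assume S: "finite S" "S \<subseteq> {1..}"
  then have "{\<omega> \<in> space M. S \<subseteq> T \<omega>} = {\<omega> \<in> space M. \<forall>k\<in>S. \<xi> k \<omega> = 1}"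
    by (auto simp: T_def)
  also have "\<dots> \<in> events" using S by (intro sets.sets_Collect_finite_All sets_eq_1) auto
  finally show ?thesis .
qed

lemma prob_subset_T:
  assumes "finite S" "S \<subseteq> {1..}"
  shows "prob {\<omega> \<in> space M. S \<subseteq> T \<omega>} = (\<Prod>k\<in>S. ln (real k) / real k)"
proof (cases "S = {}")
  case True
  then show ?thesis by (simp add: prob_space)
next
  case False
  have "{\<omega> \<in> space M. S \<subseteq> T \<omega>} = (\<Inter>k\<in>S. \<xi> k -` {1} \<inter> space M)"
    using False assms(2) by (auto simp: T_def)
  also have "prob \<dots> = (\<Prod>k\<in>S. prob (\<xi> k -` {1} \<inter> space M))"
    by (rule indep_varsD[OF indep]) (use False assms in auto)
  also have "\<dots> = (\<Prod>k\<in>S. ln (real k) / real k)"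
  proof (rule prod.cong[OF refl])
    fix k assume "k \<in> S"
    then have "prob {\<omega> \<in> space M. \<xi> k \<omega> = 1} = ln (real k) / real k" using assms(2) by (intro prob_eq_1) auto
    then show "prob (\<xi> k -` {1} \<inter> space M) = ln (real k) / real k"
      by (simp add: vimage_def Int_def conj_commute)
  qed
  finally show ?thesis .
qed

lemma
  fixes t :: real
  shows integrable_exp_count: "integrable M (\<lambda>\<omega>. exp (t * real (card (T \<omega> \<inter> {..<2 ^ J}))))"
    and expectation_exp_count_le: "expectation (\<lambda>\<omega>. exp (t * real (card (T \<omega> \<inter> {..<2 ^ J}))))
      \<le> exp ((exp t - 1) * (\<Sum>k\<in>{1..<2 ^ J}. ln (real k) / real k))"
proof -
  let ?I = "{1..<2 ^ J} :: nat set"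
  have indep': "indep_vars (\<lambda>_. borel) (\<lambda>k \<omega>. exp (t * real (\<xi> k \<omega>))) ?I"
    by (rule indep_vars_compose2[OF indep_vars_subset[OF indep]]) auto
  have eq1: "exp (t * real (\<xi> k \<omega>)) = 1 + (exp t - 1) * indicator {\<omega> \<in> space M. \<xi> k \<omega> = 1} \<omega>"
    if "k \<ge> 1" "\<omega> \<in> space M" for k \<omega>
    using values_01[OF that] that by auto
  have int: "integrable M (\<lambda>\<omega>. exp (t * real (\<xi> k \<omega>)))"
    and E: "expectation (\<lambda>\<omega>. exp (t * real (\<xi> k \<omega>))) = 1 + (exp t - 1) * (ln (real k) / real k)"
    if "k \<ge> 1" for k
  proof -
    have ind: "integrable M (\<lambda>\<omega>. 1 + (exp t - 1) * indicator {\<omega> \<in> space M. \<xi> k \<omega> = 1} \<omega> :: real)"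
      using sets_eq_1[OF that] by (intro Bochner_Integration.integrable_add integrable_mult_right) (auto simp: less_top[symmetric])
    then show "integrable M (\<lambda>\<omega>. exp (t * real (\<xi> k \<omega>)))"
      by (rule Bochner_Integration.integrable_cong[THEN iffD1, rotated -1]) (use eq1 that in auto)
    have "expectation (\<lambda>\<omega>. exp (t * real (\<xi> k \<omega>)))
        = expectation (\<lambda>\<omega>. 1 + (exp t - 1) * indicator {\<omega> \<in> space M. \<xi> k \<omega> = 1} \<omega>)"
      by (rule Bochner_Integration.integral_cong) (use eq1 that in auto)
    also have "\<dots> = 1 + (exp t - 1) * prob {\<omega> \<in> space M. \<xi> k \<omega> = 1}"
      using sets_eq_1[OF that] by (subst Bochner_Integration.integral_add) (auto simp: prob_space less_top[symmetric] Int_absorb1)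
    finally show "expectation (\<lambda>\<omega>. exp (t * real (\<xi> k \<omega>))) = 1 + (exp t - 1) * (ln (real k) / real k)"
      using prob_eq_1[OF that] by simp
  qed
  have eq: "(\<Prod>k\<in>?I. exp (t * real (\<xi> k \<omega>))) = exp (t * real (card (T \<omega> \<inter> {..<2 ^ J})))" if "\<omega> \<in> space M" for \<omega>
  proof -
    have "(\<Sum>k\<in>?I. real (\<xi> k \<omega>)) = (\<Sum>k\<in>?I. if k \<in> T \<omega> then 1 else 0)"
      using values_01[OF _ that] by (intro sum.cong) (auto simp: T_def)
    also have "\<dots> = real (card (T \<omega> \<inter> ?I))" by (simp add: sum.If_cases Int_commute)
    also have "T \<omega> \<inter> ?I = T \<omega> \<inter> {..<2 ^ J}" by (auto simp: T_def)
    finally show ?thesis by (simp add: exp_sum[symmetric] sum_distrib_left[symmetric])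
  qed
  have "integrable M (\<lambda>\<omega>. \<Prod>k\<in>?I. exp (t * real (\<xi> k \<omega>)))"
    using indep' int by (intro indep_vars_integrable) auto
  then show "integrable M (\<lambda>\<omega>. exp (t * real (card (T \<omega> \<inter> {..<2 ^ J}))))"
    by (rule Bochner_Integration.integrable_cong[THEN iffD1, rotated -1]) (use eq in auto)
  have "expectation (\<lambda>\<omega>. exp (t * real (card (T \<omega> \<inter> {..<2 ^ J}))))
      = expectation (\<lambda>\<omega>. \<Prod>k\<in>?I. exp (t * real (\<xi> k \<omega>)))"
    by (rule Bochner_Integration.integral_cong) (use eq in auto)
  also have "\<dots> = (\<Prod>k\<in>?I. expectation (\<lambda>\<omega>. exp (t * real (\<xi> k \<omega>))))"
    using indep' int by (intro indep_vars_lebesgue_integral) auto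
  also have "\<dots> = (\<Prod>k\<in>?I. 1 + (exp t - 1) * (ln (real k) / real k))"
    by (intro prod.cong) (use E in auto)
  also have "\<dots> \<le> (\<Prod>k\<in>?I. exp ((exp t - 1) * (ln (real k) / real k)))"
  proof (rule prod_mono, intro conjI exp_ge_add_one_self)
    fix k assume k: "k \<in> ?I"
    then have "k \<ge> 1" by simp
    \<comment> \<open>For negative \<open>t\<close> this is clear from reading the factor as the
      expectation of an exponential.\<close>
    show "0 \<le> 1 + (exp t - 1) * (ln (real k) / real k)"
      unfolding E[OF \<open>k \<ge> 1\<close>, symmetric] by (intro Bochner_Integration.integral_nonneg) auto
  qed
  also have "\<dots> = exp ((exp t - 1) * (\<Sum>k\<in>?I. ln (real k) / real k))"
    by (simp add: exp_sum[symmetric] sum_distrib_left)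
  finally show "expectation (\<lambda>\<omega>. exp (t * real (card (T \<omega> \<inter> {..<2 ^ J}))))
      \<le> exp ((exp t - 1) * (\<Sum>k\<in>?I. ln (real k) / real k))" .
qed

text \<open>Markov's inequality for the exponential. The factor \<open>t\<close> stays inside the
  event so that \<open>t = 1\<close> and \<open>t = - 1\<close> give the two tails.\<close>

lemma count_chernoff:
  "{\<omega> \<in> space M. u \<le> t * real (card (T \<omega> \<inter> {..<2 ^ J}))} \<in> events" (is "?E \<in> _")
  "prob {\<omega> \<in> space M. u \<le> t * real (card (T \<omega> \<inter> {..<2 ^ J}))}
     \<le> exp ((exp t - 1) * (\<Sum>k\<in>{1..<2 ^ J}. ln (real k) / real k) - u)"
proof -
  let ?f = "\<lambda>\<omega>. exp (t * real (card (T \<omega> \<inter> {..<2 ^ J})))"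
  have eq: "?E = {\<omega> \<in> space M. exp u \<le> ?f \<omega>}" by simp
  show "?E \<in> events"
    unfolding eq using borel_measurable_integrable[OF integrable_exp_count[of t J]] by measurable
  have "prob {\<omega> \<in> space M. exp u \<le> ?f \<omega>} \<le> expectation ?f / exp u"
    by (rule integral_Markov_inequality_measure[where A = "{}"]) (use integrable_exp_count in auto)
  also have "\<dots> \<le> exp ((exp t - 1) * (\<Sum>k\<in>{1..<2 ^ J}. ln (real k) / real k)) / exp u"
    by (intro divide_right_mono expectation_exp_count_le) auto
  finally show "prob ?E \<le> exp ((exp t - 1) * (\<Sum>k\<in>{1..<2 ^ J}. ln (real k) / real k) - u)"
    unfolding eq by (simp add: exp_diff)
qed

section \<open>Almost sure bounds for the counting function\<close>

lemma AE_eventually_not: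
  assumes "\<And>n. E n \<in> events" and "eventually (\<lambda>n. prob (E n) \<le> b n) sequentially" "summable b"
  shows "AE \<omega> in M. eventually (\<lambda>n. \<omega> \<notin> E n) sequentially"
proof -
  have "summable (\<lambda>n. prob (E n))"
    using assms(2) by (intro summable_comparison_test_ev[OF _ assms(3)]) simp
  then have "AE \<omega> in M. eventually (\<lambda>n. \<omega> \<in> space M - E n) sequentially"
    by (intro borel_cantelli_AE1 assms(1)) (auto simp: less_top[symmetric])
  then show ?thesis by eventually_elim (auto elim: eventually_mono)
qed

lemma summable_exp_minus: "summable (\<lambda>J. exp (- real J))"
proof -
  have "(\<lambda>J. exp (- real J)) = (\<lambda>J. exp (-1) ^ J)" by (simp add: fun_eq_iff exp_of_nat_mult[symmetric])
  then show ?thesis by (simp add: summable_geometric)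
qed

lemma AE_count_le:
  "AE \<omega> in M. eventually (\<lambda>J. real (card (T \<omega> \<inter> {..<2 ^ J})) \<le> 4 * (real J)\<^sup>2) sequentially"
proof -
  have "AE \<omega> in M. eventually (\<lambda>J. \<omega> \<notin> {\<omega> \<in> space M. 4 * (real J)\<^sup>2 \<le> 1 * real (card (T \<omega> \<inter> {..<2 ^ J}))}) sequentially"
  proof (rule AE_eventually_not[OF count_chernoff(1) always_eventually summable_exp_minus], rule allI)
    fix J
    \<comment> \<open>Since \<open>exp 1 \<le> 3\<close>, the Chernoff exponent is at most
      \<open>2 * J\<^sup>2 - 4 * J\<^sup>2\<close>, hence at most \<open>- J\<close>.\<close>
    have "(exp 1 - 1) * (\<Sum>k\<in>{1..<2 ^ J}. ln (real k) / real k) \<le> 2 * (real J)\<^sup>2"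
      using exp_le by (intro mult_mono sum_ln_over_self_bounds) (auto intro!: sum_nonneg divide_nonneg_nonneg)
    moreover have "real J \<le> (real J)\<^sup>2" using of_nat_mono[of J "J\<^sup>2"] by (simp add: power2_eq_square)
    ultimately have "exp ((exp 1 - 1) * (\<Sum>k\<in>{1..<2 ^ J}. ln (real k) / real k) - 4 * (real J)\<^sup>2) \<le> exp (- real J)"
      unfolding exp_le_cancel_iff by linarith
    then show "prob {\<omega> \<in> space M. 4 * (real J)\<^sup>2 \<le> 1 * real (card (T \<omega> \<inter> {..<2 ^ J}))} \<le> exp (- real J)"
      by (rule order_trans[OF count_chernoff(2)])
  qed
  then show ?thesis
    using AE_space by eventually_elim (auto elim!: eventually_mono)
qed

lemma AE_count_ge:
  "AE \<omega> in M. eventually (\<lambda>J. 1 / 64 * (real J)\<^sup>2 \<le> real (card (T \<omega> \<inter> {..<2 ^ J}))) sequentially"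
proof -
  have "AE \<omega> in M. eventually (\<lambda>J. \<omega> \<notin> {\<omega> \<in> space M. - (1 / 64 * (real J)\<^sup>2) \<le> - 1 * real (card (T \<omega> \<inter> {..<2 ^ J}))}) sequentially"
  proof (rule AE_eventually_not[OF count_chernoff(1) _ summable_exp_minus])
    show "eventually (\<lambda>J. prob {\<omega> \<in> space M. - (1 / 64 * (real J)\<^sup>2) \<le> - 1 * real (card (T \<omega> \<inter> {..<2 ^ J}))}
        \<le> exp (- real J)) sequentially"
      \<comment> \<open>The Chernoff exponent at \<open>t = - 1\<close> is at most - J (J - 1) / 16
        + J^2 / 64, which lies below - J for \<open>J\<close> at least 66.\<close>
      using eventually_ge_at_top[of 66]
    proof eventually_elim
      case (elim J)
      let ?s = "\<Sum>k\<in>{1..<2 ^ J}. ln (real k) / real k"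
      have "2 \<le> exp (1::real)" using exp_ge_add_one_self[of 1] by simp
      then have "exp (-1) \<le> (1 / 2 :: real)" by (simp add: exp_minus divide_simps)
      moreover have "0 \<le> ?s" by (intro sum_nonneg divide_nonneg_nonneg) auto
      ultimately have "(exp (-1) - 1) * ?s \<le> (- (1 / 2)) * ?s" by (intro mult_right_mono) auto
      moreover have "real J * (real J - 1) / 8 \<le> ?s" by (rule sum_ln_over_self_bounds)
      moreover have "66 * real J \<le> real J * real J" using elim by (intro mult_right_mono) auto
      then have "- (real J * (real J - 1) / 16) + 1 / 64 * (real J)\<^sup>2 \<le> - real J"
        by (simp add: power2_eq_square algebra_simps)
      ultimately have "(exp (-1) - 1) * ?s - (- (1 / 64 * (real J)\<^sup>2)) \<le> - real J" by linarith
      then show ?case by (intro order_trans[OF count_chernoff(2)]) simp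
    qed
  qed
  then show ?thesis
    using AE_space by eventually_elim (auto elim!: eventually_mono)
qed

section \<open>Short relations in the random set\<close>

definition signed_sum :: "nat \<Rightarrow> (nat \<Rightarrow> int) \<Rightarrow> nat" where
  "signed_sum j c = nat \<bar>\<Sum>k\<in>{1..<2 ^ Suc j}. c k * int k\<bar>"

definition support :: "nat \<Rightarrow> (nat \<Rightarrow> int) \<Rightarrow> nat set" where
  "support j c = {k \<in> {1..<2 ^ Suc j}. c k \<noteq> 0}"

text \<open>A relation is determined by its coefficients off its largest element, which is then
  \<open>signed_sum j c\<close>; so the union bound runs over the coefficients of the smaller elements only.\<close>

definition short_patterns :: "nat \<Rightarrow> (nat \<Rightarrow> int) set" where
  "short_patterns j = {c \<in> {1..<2 ^ Suc j} \<rightarrow>\<^sub>E {-1, 0, 1}. 2 ^ j \<le> signed_sum j c \<and> signed_sum j c < 2 ^ Suc j \<and>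
      signed_sum j c \<notin> support j c \<and> (2 * (real j + 1)\<^sup>2) ^ Suc (card (support j c)) \<le> sqrt 2 ^ j}"

text \<open>Covers the failure of \<open>long_relations\<close> at \<open>j\<close>. Patterns with
  support elements above the signed sum are counted as well, which only enlarges the event.\<close>

definition short_event :: "nat \<Rightarrow> 'a set" where
  "short_event j = (\<Union>c\<in>short_patterns j. {\<omega> \<in> space M. insert (signed_sum j c) (support j c) \<subseteq> T \<omega>})"

lemma finite_short_patterns: "finite (short_patterns j)"
  unfolding short_patterns_def by (intro finite_subset[OF _ finite_PiE[of "{1..<2 ^ Suc j}" "\<lambda>_. {-1, 0, 1}"]]) auto

lemma pattern_subset:
  assumes "c \<in> short_patterns j"
  shows "finite (insert (signed_sum j c) (support j c))" "insert (signed_sum j c) (support j c) \<subseteq> {1..}"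
proof -
  have "1 \<le> (2::nat) ^ j" by simp
  also have "\<dots> \<le> signed_sum j c" using assms by (simp add: short_patterns_def)
  finally show "insert (signed_sum j c) (support j c) \<subseteq> {1..}" by (auto simp: support_def)
qed (simp add: support_def)

lemma short_event_sets: "short_event j \<in> events"
  unfolding short_event_def by (intro sets.finite_UN finite_short_patterns sets_subset_T pattern_subset)

text \<open>The element \<open>signed_sum j c\<close> is present with probability at most (j + 1) /
  2^j. Shortness of the pattern allows half of this decay to be traded for a damping factor 1 /
  \<open>L\<close> per support element. The damped weights of all patterns then factor over
  \<open>k\<close> and sum to at most \<open>exp 1\<close>.\<close>

lemma prob_short_event_le: "prob (short_event j) \<le> exp 1 * ((real j + 1) * (1 / sqrt 2) ^ j)"
proof -
  \<comment> \<open>Twice the bound \<open>(j + 1)\<^sup>2\<close> for the sum of the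
    \<open>\<delta> k\<close>, so that the product of the factors
    \<open>1 + 2 * \<delta> k / L\<close> is at most \<open>exp 1\<close>.\<close>
  define L where "L = 2 * (real j + 1)\<^sup>2"
  have "1 \<le> (real j + 1)\<^sup>2" by (simp add: one_le_power)
  then have "L \<ge> 1" unfolding L_def by linarith
  define \<delta> where "\<delta> = (\<lambda>k. ln (real k) / real k)"
  define I where "I = {1..<2 ^ Suc j :: nat}"
  have \<delta>_nonneg: "\<delta> k \<ge> 0" if "k \<ge> 1" for k using that by (simp add: \<delta>_def)
  define w where "w = (\<lambda>k (e::int). if e = 0 then 1 else \<delta> k / L)"
  have w_nonneg: "w k e \<ge> 0" if "k \<in> I" for k e
    using that \<delta>_nonneg[of k] \<open>L \<ge> 1\<close> by (auto simp: w_def I_def)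
  have pattern: "prob {\<omega> \<in> space M. insert (signed_sum j c) (support j c) \<subseteq> T \<omega>}
      \<le> (real j + 1) * (1 / sqrt 2) ^ j * (\<Prod>k\<in>I. w k (c k))" if c: "c \<in> short_patterns j" for c
  proof -
    define v where "v = signed_sum j c"
    define S where "S = support j c"
    have v: "2 ^ j \<le> v" "v < 2 ^ Suc j" "v \<notin> S" and LS: "L ^ Suc (card S) \<le> sqrt 2 ^ j"
      using c by (auto simp: short_patterns_def v_def S_def L_def)
    have "finite S" "S \<subseteq> I" by (auto simp: S_def support_def I_def)
    have "real (2 ^ j) \<le> real v" "real v \<le> real (2 ^ Suc j)" using v(1,2) by (simp_all only: of_nat_le_iff less_imp_le)
    then have v': "2 ^ j \<le> real v" "real v \<le> 2 ^ Suc j" by simp_all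
    have "0 < real v" by (rule less_le_trans[OF _ v'(1)]) simp
    have "ln (real v) \<le> ln (2 ^ Suc j)" using v'(2) \<open>0 < real v\<close> by simp
    also have "\<dots> = (real j + 1) * ln 2" by (subst ln_realpow) auto
    also have "\<dots> \<le> (real j + 1) * 1" using ln_2_less_1 by (intro mult_left_mono) auto
    finally have "\<delta> v \<le> (real j + 1) / 2 ^ j" unfolding \<delta>_def using v'(1) by (intro frac_le) auto
    have prodS: "(\<Prod>k\<in>S. \<delta> k) \<ge> 0" using \<open>S \<subseteq> I\<close> by (intro prod_nonneg \<delta>_nonneg) (auto simp: I_def)
    have "prob {\<omega> \<in> space M. insert v S \<subseteq> T \<omega>} = (\<Prod>k\<in>insert v S. \<delta> k)"
      unfolding \<delta>_def v_def S_def by (rule prob_subset_T[OF pattern_subset[OF c]])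
    \<comment> \<open>Here \<open>v \<notin> S\<close> matters: it yields the additional factor
      \<open>\<delta> v\<close>, the source of the decay in \<open>j\<close>.\<close>
    also have "\<dots> = \<delta> v * (\<Prod>k\<in>S. \<delta> k)" using v \<open>finite S\<close> by simp
    also have "\<dots> \<le> (real j + 1) / 2 ^ j * (\<Prod>k\<in>S. \<delta> k)"
      by (intro mult_right_mono prodS) fact
    \<comment> \<open>The inserted factor is at least 1 because the pattern is short.\<close>
    also have "\<dots> \<le> (real j + 1) / 2 ^ j * (sqrt 2 ^ j * (1 / L) ^ card S * (\<Prod>k\<in>S. \<delta> k))"
    proof -
      have "L ^ card S \<le> L ^ Suc (card S)" using \<open>L \<ge> 1\<close> by (intro power_increasing) auto
      then have "L ^ card S \<le> sqrt 2 ^ j" using LS by linarith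
      then have "1 \<le> sqrt 2 ^ j * (1 / L) ^ card S"
        using \<open>L \<ge> 1\<close> by (simp add: power_divide le_divide_eq)
      then show ?thesis
        using mult_right_mono[of 1 "sqrt 2 ^ j * (1 / L) ^ card S", OF _ prodS]
        by (intro mult_left_mono) auto
    qed
    also have "\<dots> = (real j + 1) * (sqrt 2 ^ j / 2 ^ j) * (\<Prod>k\<in>S. \<delta> k / L)"
      by (simp add: prod_dividef power_divide)
    also have "(\<Prod>k\<in>S. \<delta> k / L) = (\<Prod>k\<in>I. w k (c k))"
    proof (rule prod.mono_neutral_cong_left)
      have cS: "k \<in> S \<longleftrightarrow> c k \<noteq> 0" if "k \<in> I" for k using that by (simp add: S_def support_def I_def)
      show "\<forall>k\<in>I - S. w k (c k) = 1" using cS by (auto simp: w_def)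
      show "\<delta> k / L = w k (c k)" if "k \<in> S" for k using cS[of k] that \<open>S \<subseteq> I\<close> by (auto simp: w_def)
    qed (use \<open>S \<subseteq> I\<close> in \<open>auto simp: I_def\<close>)
    also have "sqrt 2 ^ j / 2 ^ j = (1 / sqrt 2) ^ j"
    proof -
      have "(2::real) ^ j = sqrt 2 ^ j * sqrt 2 ^ j" by (simp flip: power_mult_distrib)
      then show ?thesis by (simp add: power_divide)
    qed
    finally show ?thesis by (simp add: v_def S_def)
  qed
  have "(\<Sum>c\<in>I \<rightarrow>\<^sub>E {-1, 0, 1}. \<Prod>k\<in>I. w k (c k)) = (\<Prod>k\<in>I. \<Sum>e\<in>{-1, 0, 1}. w k e)"
    by (rule prod_sum_PiE[symmetric]) (auto simp: I_def)
  also have "\<dots> \<le> (\<Prod>k\<in>I. exp (2 * \<delta> k / L))"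
  proof (rule prod_mono, intro conjI)
    fix k assume "k \<in> I"
    show "(\<Sum>e\<in>{-1, 0, 1}. w k e) \<le> exp (2 * \<delta> k / L)"
    proof -
      have "(\<Sum>e\<in>{-1, 0, 1}. w k e) = 1 + 2 * \<delta> k / L" by (simp add: w_def)
      also have "\<dots> \<le> exp (2 * \<delta> k / L)" by (rule exp_ge_add_one_self)
      finally show ?thesis .
    qed
    show "0 \<le> (\<Sum>e\<in>{-1, 0, 1}. w k e)" by (intro sum_nonneg w_nonneg \<open>k \<in> I\<close>)
  qed
  also have "\<dots> = exp (2 / L * (\<Sum>k\<in>I. \<delta> k))" by (simp add: I_def exp_sum[symmetric] sum_distrib_left)
  also have "\<dots> \<le> exp 1"
  proof -
    have "2 / L * (\<Sum>k\<in>I. \<delta> k) \<le> 2 / L * (real (Suc j))\<^sup>2"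
      unfolding I_def \<delta>_def using \<open>L \<ge> 1\<close> by (intro mult_left_mono sum_ln_over_self_bounds) auto
    also have "\<dots> = 1" using \<open>L \<ge> 1\<close> by (simp add: L_def add.commute)
    finally show ?thesis by simp
  qed
  finally have total: "(\<Sum>c\<in>I \<rightarrow>\<^sub>E {-1, 0, 1}. \<Prod>k\<in>I. w k (c k)) \<le> exp 1" .
  have "prob (short_event j) \<le> (\<Sum>c\<in>short_patterns j. prob {\<omega> \<in> space M. insert (signed_sum j c) (support j c) \<subseteq> T \<omega>})"
    unfolding short_event_def
    by (intro finite_measure_subadditive_finite finite_short_patterns image_subsetI sets_subset_T pattern_subset)
  also have "\<dots> \<le> (\<Sum>c\<in>short_patterns j. (real j + 1) * (1 / sqrt 2) ^ j * (\<Prod>k\<in>I. w k (c k)))"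
    by (intro sum_mono pattern)
  also have "\<dots> = (real j + 1) * (1 / sqrt 2) ^ j * (\<Sum>c\<in>short_patterns j. \<Prod>k\<in>I. w k (c k))"
    by (simp add: sum_distrib_left)
  also have "\<dots> \<le> (real j + 1) * (1 / sqrt 2) ^ j * (\<Sum>c\<in>I \<rightarrow>\<^sub>E {-1, 0, 1}. \<Prod>k\<in>I. w k (c k))"
    by (intro mult_left_mono sum_mono2 finite_PiE prod_nonneg w_nonneg)
      (auto simp: short_patterns_def I_def)
  also have "\<dots> \<le> (real j + 1) * (1 / sqrt 2) ^ j * exp 1"
    by (intro mult_left_mono total) auto
  finally show ?thesis by (simp add: mult_ac)
qed

lemma AE_relations_long:
  "AE \<omega> in M. eventually (\<lambda>j. long_relations (T \<omega>) j) sequentially"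
proof -
  have "AE \<omega> in M. eventually (\<lambda>j. \<omega> \<notin> short_event j) sequentially"
  proof (rule AE_eventually_not[OF short_event_sets always_eventually])
    show "\<forall>j. prob (short_event j) \<le> exp 1 * ((real j + 1) * (1 / sqrt 2) ^ j)" by (simp add: prob_short_event_le)
    have "summable (\<lambda>j. of_nat (Suc j) * (1 / sqrt 2) ^ j :: real)"
      by (rule sums_summable[OF geometric_deriv_sums]) (simp add: divide_simps)
    then show "summable (\<lambda>j. exp 1 * ((real j + 1) * (1 / sqrt 2) ^ j))" by (intro summable_mult) (simp add: add.commute)
  qed
  then show ?thesis
    using AE_space
  proof eventually_elim
    case (elim \<omega>)
    show ?case using elim(1)
    proof eventually_elim
      case (elim j)
      show ?case unfolding long_relations_def
      proof (intro allI impI, rule ccontr)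
        fix S n
        assume S: "finite S" "S \<subseteq> T \<omega>" and n: "n \<in> S" "\<forall>k\<in>S. k \<le> n" "2 ^ j \<le> n" "n < 2 ^ Suc j"
          and rel: "\<not> relation_free (int ` S)" and short: "\<not> sqrt 2 ^ j < (2 * (real j + 1)\<^sup>2) ^ card S"
        define I where "I = {1..<2 ^ Suc j :: nat}"
        have SI: "S \<subseteq> I" using S(2) n by (force simp: I_def T_def)
        obtain b where b: "\<And>k. k \<in> S \<Longrightarrow> b (int k) \<in> {-1, 1::int}" and b0: "(\<Sum>k\<in>S. b (int k) * int k) = 0"
          using rel unfolding relation_free_def by (auto simp: sum.reindex)
        \<comment> \<open>The relation with its largest element deleted. The deleted term reappears,
          up to sign, as the value of the remaining sum; the default \<open>undefined\<close> makes
          \<open>c\<close> extensional.\<close>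
        define c where "c = (\<lambda>k. if k \<in> I then (if k \<in> S - {n} then b (int k) else 0) else undefined)"
        have "(\<Sum>k\<in>I. c k * int k) = (\<Sum>k\<in>S - {n}. b (int k) * int k)"
          using SI by (intro sum.mono_neutral_cong_right) (auto simp: c_def I_def)
        also have "\<dots> = - (b (int n) * int n)"
          using b0 sum.remove[OF S(1) n(1), of "\<lambda>k. b (int k) * int k"] by simp
        finally have "signed_sum j c = n"
          using b[OF n(1)] by (auto simp: signed_sum_def I_def abs_mult)
        have supp: "support j c = S - {n}"
        proof -
          have "c k \<noteq> 0 \<longleftrightarrow> k \<in> S - {n}" if "k \<in> I" for k
            using b[of k] that by (cases "k \<in> S") (auto simp: c_def)
          moreover have "support j c = {k \<in> I. c k \<noteq> 0}" by (simp add: support_def I_def)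
          ultimately show ?thesis using SI by blast
        qed
        have "c k \<in> {-1, 0, 1}" if "k \<in> I" for k
          using b[of k] that by (cases "k \<in> S") (auto simp: c_def)
        then have "c \<in> I \<rightarrow>\<^sub>E {-1, 0, 1}" by (intro PiE_I) (auto simp: c_def)
        moreover have "Suc (card (S - {n})) = card S" using S(1) n(1) by (rule card_Suc_Diff1)
        ultimately have "c \<in> short_patterns j"
          using n short \<open>signed_sum j c = n\<close> by (simp add: short_patterns_def supp I_def del: power_Suc)
        moreover have "insert (signed_sum j c) (support j c) \<subseteq> T \<omega>"
          using \<open>signed_sum j c = n\<close> n(1) S(2) by (auto simp: supp)
        ultimately have "\<omega> \<in> short_event j" using \<open>\<omega> \<in> space M\<close> unfolding short_event_def by blast
        with elim show False by simp
      qed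
    qed
  qed
qed

end

text \<open>The largest element of a relation above \<open>2 ^ J\<close> lies in a block with index
  \<open>j \<ge> J\<close>, so a bound in terms of \<open>j\<close> suffices. For large
  \<open>j\<close> the length exceeds a multiple of y / log y with y = j + 1, and the logarithm is
  absorbed by a small power; the remaining blocks only affect the constant.\<close>

lemma sparse_relations_if_eventually_long:
  assumes "0 \<notin> T" and e: "0 < e" "e < 1 / 2"
    and long: "eventually (long_relations T) sequentially"
  shows "sparse_relations T e"
proof -
  obtain j0 where j0: "\<And>j. j \<ge> j0 \<Longrightarrow> long_relations T j"
    using long unfolding eventually_sequentially by blast
  \<comment> \<open>The logarithm is bounded by a multiple of \<open>y powr a\<close>, and
    \<open>y = y powr (2 * e) * y powr a\<close>.\<close>
  define a where "a = 1 - 2 * e"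
  have "a > 0" using e by (simp add: a_def)
  define B where "B = 1 + 2 / a"
  have "B \<ge> 1" using \<open>a > 0\<close> by (simp add: B_def)
  \<comment> \<open>\<open>c1\<close> serves the large blocks, its 8 coming from
    \<open>y / 8 \<le> j * (ln 2 / 2)\<close>; \<open>c2\<close> serves the others, where
    \<open>card S \<ge> 1\<close> is enough.\<close>
  define c1 where "c1 = 1 / (8 * B)"
  define c2 where "c2 = 1 / real (j0 + 2) powr (2 * e)"
  have c1: "0 < c1" "c1 \<le> 1" using \<open>B \<ge> 1\<close> by (auto simp: c1_def)
  have "real (j0 + 2) powr (2 * e) \<ge> 1" using e by (intro ge_one_powr_ge_zero) auto
  then have c2: "0 < c2" "c2 \<le> 1" by (auto simp: c2_def)
  define c where "c = min c1 c2"
  have "c * real (J + 1) powr (2 * e) \<le> real (card S)"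
    if S: "finite S" "S \<noteq> {}" "S \<subseteq> T \<inter> {2 ^ J..}" and rel: "\<not> relation_free (int ` S)" for J S
  proof -
    define n where "n = Max S"
    have n: "n \<in> S" "\<forall>k\<in>S. k \<le> n" using S by (auto simp: n_def)
    then have "n > 0" using S \<open>0 \<notin> T\<close> by (auto intro!: Nat.gr0I)
    then obtain j where j: "2 ^ j \<le> n" "n < 2 ^ Suc j" using ex_power_ivl1[of 2 n] by auto
    have "2 ^ J \<le> n" using n(1) S(3) by auto
    also note j(2)
    finally have "J < Suc j" by (rule power_less_imp_less_exp[rotated]) simp
    then have "real (J + 1) \<le> real (j + 1)" by simp
    then have Jj: "real (J + 1) powr (2 * e) \<le> real (j + 1) powr (2 * e)" using e by (intro powr_mono2) auto
    have "card S \<ge> 1" using S by (simp add: Suc_le_eq card_gt_0_iff)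
    show ?thesis
    proof (cases "j \<ge> j0 \<and> j \<ge> 1")
      case False
      then have "j + 1 \<le> j0 + 2" by auto
      then have "real (j + 1) \<le> real (j0 + 2)" by (rule of_nat_mono)
      then have "real (j + 1) powr (2 * e) \<le> real (j0 + 2) powr (2 * e)" using e by (intro powr_mono2) auto
      then have "c * real (J + 1) powr (2 * e) \<le> c2 * real (j0 + 2) powr (2 * e)"
        using Jj c1 c2 by (intro mult_mono) (auto simp: c_def)
      also have "\<dots> = 1" by (simp add: c2_def)
      finally show ?thesis using \<open>card S \<ge> 1\<close> by linarith
    next
      case True
      define y where "y = real (j + 1)"
      have "y \<ge> 2" using True by (simp add: y_def)
      have "sqrt 2 ^ j < (2 * y\<^sup>2) ^ card S"
        using long_relationsD[OF j0 S(1) _ n j rel] True S(3) by (auto simp: y_def add.commute)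
      then have "ln (sqrt 2 ^ j) < ln ((2 * y\<^sup>2) ^ card S)" using \<open>y \<ge> 2\<close> by (subst ln_less_cancel_iff) auto
      also have "\<dots> = real (card S) * (ln 2 + 2 * ln y)"
        using \<open>y \<ge> 2\<close> by (simp add: ln_realpow ln_mult algebra_simps)
      also have "ln (sqrt 2 ^ j) = real j * (ln 2 / 2)" by (simp add: ln_realpow ln_sqrt)
      finally have less: "real j * (ln 2 / 2) < real (card S) * (ln 2 + 2 * ln y)" .
      have "y / 8 \<le> real j * (ln 2 / 2)"
      proof -
        have "y / 8 \<le> real j * (1 / 4)" using True by (simp add: y_def)
        also have "\<dots> \<le> real j * (ln 2 / 2)" using ln2_ge_two_thirds by (intro mult_left_mono) auto
        finally show ?thesis .
      qed
      also note less
      also have "real (card S) * (ln 2 + 2 * ln y) \<le> real (card S) * (B * y powr a)"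
      proof (intro mult_left_mono)
        have "ln y \<le> y powr a / a" using \<open>y \<ge> 2\<close> \<open>a > 0\<close> by (intro ln_powr_bound) auto
        moreover have "ln 2 \<le> (1::real)" using ln_2_less_1 by simp
        moreover have "1 \<le> y powr a" using \<open>y \<ge> 2\<close> \<open>a > 0\<close> by (intro ge_one_powr_ge_zero) auto
        ultimately have "ln 2 + 2 * ln y \<le> y powr a + 2 * (y powr a / a)" by linarith
        also have "\<dots> = B * y powr a" by (simp add: B_def algebra_simps)
        finally show "ln 2 + 2 * ln y \<le> B * y powr a" .
      qed auto
      finally have lt: "y / 8 < real (card S) * (B * y powr a)" .
      have "y = y powr (2 * e) * y powr a" using \<open>y \<ge> 2\<close> by (simp add: a_def flip: powr_add)
      with lt have "(y powr (2 * e) / 8) * y powr a < (real (card S) * B) * y powr a" by (simp add: mult_ac)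
      then have "y powr (2 * e) / 8 < real (card S) * B" using \<open>y \<ge> 2\<close> by (subst (asm) mult_less_cancel_right_pos) auto
      then have "c1 * y powr (2 * e) < real (card S)" using \<open>B \<ge> 1\<close> by (simp add: c1_def field_simps)
      moreover have "c * real (J + 1) powr (2 * e) \<le> c1 * y powr (2 * e)"
        using Jj c1 c2 by (intro mult_mono) (auto simp: c_def y_def)
      ultimately show ?thesis by linarith
    qed
  qed
  moreover have "0 < c" "c \<le> 1" using c1 c2 by (auto simp: c_def)
  ultimately show ?thesis unfolding sparse_relations_def by blast
qed

lemma count_le_if_eventually:
  fixes T :: "nat set"
  assumes "0 \<notin> T" and "eventually (\<lambda>J. real (card (T \<inter> {..<2 ^ J})) \<le> 4 * (real J)\<^sup>2) sequentially"
  shows "\<exists>K. \<forall>J. real (card (T \<inter> {..<2 ^ J})) \<le> K * (real J)\<^sup>2"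
proof -
  obtain J0 where J0: "\<And>J. J \<ge> J0 \<Longrightarrow> real (card (T \<inter> {..<2 ^ J})) \<le> 4 * (real J)\<^sup>2"
    using assms(2) unfolding eventually_sequentially by blast
  have "real (card (T \<inter> {..<2 ^ J})) \<le> (4 + 2 ^ J0) * (real J)\<^sup>2" for J
  proof (cases "J \<ge> J0")
    case True
    then show ?thesis using J0[of J] by (simp add: algebra_simps add_increasing2)
  next
    case False
    show ?thesis
    proof (cases "J = 0")
      case True
      \<comment> \<open>At \<open>J = 0\<close> the right side vanishes for every constant, so the
        count itself must vanish; this rests on \<open>0 \<notin> T\<close>.\<close>
      then have "T \<inter> {..<2 ^ J} = {}" using assms(1) by (auto simp: less_Suc_eq)
      then show ?thesis by simp
    next
      case J: False
      have "card (T \<inter> {..<2 ^ J}) \<le> card {..<2 ^ J :: nat}" by (intro card_mono) auto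
      then have "real (card (T \<inter> {..<2 ^ J})) \<le> real (2 ^ J)" by (simp only: of_nat_le_iff card_lessThan)
      also have "\<dots> \<le> 2 ^ J0 * 1" using False by (simp add: power_increasing)
      also have "\<dots> \<le> (4 + 2 ^ J0) * (real J)\<^sup>2" using J by (intro mult_mono) (auto simp: one_le_power)
      finally show ?thesis .
    qed
  qed
  then show ?thesis by blast
qed

theorem theorem5p7:
  fixes M :: "'a measure" and \<xi> :: "nat \<Rightarrow> 'a \<Rightarrow> nat"
  assumes "prob_space M"
    and "prob_space.indep_vars M (\<lambda>_. count_space UNIV) \<xi> {1..}"
    and "\<And>k \<omega>. k \<ge> 1 \<Longrightarrow> \<omega> \<in> space M \<Longrightarrow> \<xi> k \<omega> \<in> {0, 1}"
    and "\<And>k. k \<ge> 1 \<Longrightarrow> measure M {\<omega> \<in> space M. \<xi> k \<omega> = 1} = ln (real k) / real k"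
  shows "AE \<omega> in M.
    (\<forall>p::real. 4/3 < p \<and> p < 2 \<longrightarrow> p_Rider p {k. k \<ge> 1 \<and> \<xi> k \<omega> = 1}) \<and>
    (\<forall>p::real. 1 \<le> p \<and> p < 4/3 \<longrightarrow> \<not> p_Rider p {k. k \<ge> 1 \<and> \<xi> k \<omega> = 1})"
proof -
  interpret prob_space M by fact
  interpret log_random_set M \<xi>
    by unfold_locales (use assms(2-4) in auto)
  \<comment> \<open>The three almost sure events do not involve \<open>p\<close>, so one null set
    serves all exponents.\<close>
  show ?thesis
    using AE_count_le AE_count_ge AE_relations_long
  proof eventually_elim
    case (elim \<omega>)
    have T: "{k. k \<ge> 1 \<and> \<xi> k \<omega> = 1} = T \<omega>" by (simp add: T_def)
    have "0 \<notin> T \<omega>" by (simp add: T_def)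
    obtain K where K: "\<And>J. real (card (T \<omega> \<inter> {..<2 ^ J})) \<le> K * (real J)\<^sup>2"
      using count_le_if_eventually[OF \<open>0 \<notin> T \<omega>\<close> elim(1)] by blast
    have "p_Rider p (T \<omega>)" if p: "4 / 3 < p" "p < 2" for p
    proof -
      \<comment> \<open>Midpoint between 2/p - 1, where \<open>p * (1 + e)\<close> equals 2, and
        1/2, the upper limit for \<open>e\<close> in
        \<open>sparse_relations_if_eventually_long\<close>. The interval between them is nonempty
        exactly for \<open>p > 4 / 3\<close>.\<close>
      define e where "e = 1 / p - 1 / 4"
      have "0 < e" "e < 1 / 2" "p * (1 + e) > 2" using p by (auto simp: e_def field_simps)
      then show ?thesis
        using sparse_relations_if_eventually_long[OF \<open>0 \<notin> T \<omega>\<close> _ _ elim(3)] p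
        by (intro p_Rider_if_sparse_relations[of "T \<omega>" e p K] \<open>0 \<notin> T \<omega>\<close> K) auto
    qed
    moreover have "\<not> p_Rider p (T \<omega>)" if "1 \<le> p" "p < 4 / 3" for p
      using that elim(2) by (intro not_p_Rider_if_dense[of p "1 / 64"]) auto
    ultimately show ?case unfolding T by blast
  qed
qed

end
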